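(* Let $(\Theta,I,\mathbf p)$ be a parametrized statistical model on the finite weighted graph $(I,E,\omega)$ and let $q\in\mathcal P_+(I)$ be a reference measure (all notions as specified in the context). Assume $\Theta$ is a compact set. If $\operatorname{Ric}(\Theta,I,\mathbf p)\ge\kappa>0$, then there exists a unique equilibrium $\theta^*\in\Theta$, with $$\theta^*=\arg\min_{\theta\in\Theta}\operatorname{D}_{\operatorname{KL}}(p(\theta)\|q).$$ In addition, for any initial condition $\theta_0\in\Theta$, the solution $\theta_t$ of the Fokker-Planck equation on parameter space (the Wasserstein gradient flow of the KL divergence) $$\frac{d\theta}{dt}=-\big(J_\theta p(\theta)^{\mathsf T}L(p(\theta))^\dagger J_\theta p(\theta)\big)^{\dagger}J_\theta p(\theta)^{\mathsf T}\log\frac{p(\theta)}{q},\qquad \log\frac{p(\theta)}{q}=\Big(\log\frac{p_i(\theta)}{q_i}\Big)_{i=1}^n,$$ converges to $\theta^*$ exponentially fast, with $$\operatorname{D}_{\operatorname{KL}}(p(\theta_t)\|q)-\operatorname{D}_{\operatorname{KL}}(p(\theta^* )\|q)\le e^{-2\kappa t}\Big(\operatorname{D}_{\operatorname{KL}}(p(\theta_0)\|q)-\operatorname{D}_{\operatorname{KL}}(p(\theta^* )\|q)\Big)\quad\text{for all }t.$$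
   Context: **Graph.** $I=\{1,\dots,n\}$ is the discrete sample space, and $(I,E,\omega)$ is a connected undirected graph with weights $\omega_{ij}=\omega_{ji}>0$ if $(i,j)\in E$ and $\omega_{ij}=0$ otherwise. $N(i)$ is the set of neighbors of $i$, and $d_i=\frac{\sum_{j\in N(i)}\omega_{ij}}{\sum_{k=1}^n\sum_{j\in N(k)}\omega_{kj}}$. $\mathcal P_+(I)=\{p\in\mathbb R^n: \sum_i p_i=1,\ p_i>0\}$. For $p\in\mathcal P_+(I)$, $L(p)\in\mathbb R^{n\times n}$ is the weighted graph Laplacian, i.e. the symmetric matrix with quadratic form (sum over undirected edges) $$\Phi^{\mathsf T}L(p)\Phi=\sum_{(i,j)\in E}\omega_{ij}(\Phi_i-\Phi_j)^2\,\tfrac12\Big(\frac{p_i}{d_i}+\frac{p_j}{d_j}\Big),$$ and $\dagger$ denotes the pseudo-inverse of a matrix. **Model.** $\Theta\subset\mathbb R^d$, $d\le n-1$, is the parameter space, and $\mathbf p:\Theta\to\mathcal P_+(I)$, $\theta\mapsto p(\theta)=(p_i(\theta))_{i=1}^n$, is the parametrization. Its Jacobi matrix $J_\theta p(\theta)=(\partial p_i/\partial\theta_j)\in\mathbb R^{n\times d}$ is assumed to have rank $d$. **Wasserstein metric on $\Theta$.** $G_W(\theta)=J_\theta p(\theta)^{\mathsf T}L(p(\theta))^\dagger J_\theta p(\theta)$, $g^W_\theta(a,b)=a^{\mathsf T}G_W(\theta)b$ for $a,b\in\mathbb R^d$, and $$d_W(\theta_0,\theta_1)^2=\inf\Big\{\int_0^1\dot\theta(t)^{\mathsf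 T}G_W(\theta(t))\dot\theta(t)\,dt:\ \theta\in C^1([0,1],\Theta),\ \theta(0)=\theta_0,\ \theta(1)=\theta_1\Big\}.$$ "Equilibrium" refers to the Fokker-Planck equation on parameter space displayed in the claim. **KL divergence.** $\operatorname{D}_{\operatorname{KL}}(p\|q)=\sum_{i=1}^n p_i\log\frac{p_i}{q_i}$. **Ricci curvature lower bound.** $\operatorname{Ric}(\Theta,I,\mathbf p)\ge\kappa$ (with respect to $q$) means: for any constant speed geodesic $\theta_t$, $t\in[0,1]$, connecting $\theta_0,\theta_1$ in $(\Theta,g^W)$, it holds that $$\operatorname{D}_{\operatorname{KL}}(p(\theta_t)\|q)\le(1-t)\operatorname{D}_{\operatorname{KL}}(p(\theta_0)\|q)+t\operatorname{D}_{\operatorname{KL}}(p(\theta_1)\|q)-\frac\kappa2t(1-t)\,d_W(\theta_0,\theta_1)^2.$$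
   Formalization: Also assumed: Θ is nonempty; any two points of Θ are joined by a C¹ curve in Θ and d_W is continuous on Θ; p is C¹ near Θ; from every θ_0 in Θ the Fokker-Planck equation has a solution staying in Θ for all t ≥ 0 (otherwise a boundary minimizer need not be an equilibrium). *)

theory Defs
  imports "HOL-Analysis.Analysis"
begin

section \<open>Weighted graphs and the graph Laplacian\<close>

text \<open>The sample space is the finite type \<open>'n\<close>. An undirected edge is represented by the two ordered
  pairs in the symmetric relation \<open>E\<close>; loops are not excluded and do not contribute to the
  Laplacian.\<close>

definition weighted_graph :: "('n::finite \<times> 'n) set \<Rightarrow> ('n \<Rightarrow> 'n \<Rightarrow> real) \<Rightarrow> bool" where
  "weighted_graph E \<omega> \<longleftrightarrow>
     sym E \<and> (\<forall>i j. (i, j) \<in> E\<^sup>*) \<and>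
     (\<forall>i j. \<omega> i j = \<omega> j i) \<and>
     (\<forall>i j. (i, j) \<in> E \<longrightarrow> \<omega> i j > 0) \<and>
     (\<forall>i j. (i, j) \<notin> E \<longrightarrow> \<omega> i j = 0)"

definition neighbors :: "('n::finite \<times> 'n) set \<Rightarrow> 'n \<Rightarrow> 'n set" where
  "neighbors E i = {j. (i, j) \<in> E}"

definition degree_dist :: "('n::finite \<times> 'n) set \<Rightarrow> ('n \<Rightarrow> 'n \<Rightarrow> real) \<Rightarrow> 'n \<Rightarrow> real" where
  "degree_dist E \<omega> i =
     (\<Sum>j\<in>neighbors E i. \<omega> i j) / (\<Sum>k\<in>UNIV. \<Sum>j\<in>neighbors E k. \<omega> k j)"

definition pos_prob :: "(real ^ 'n) set" where
  "pos_prob = {p. (\<Sum>i\<in>UNIV. p $ i) = 1 \<and> (\<forall>i. p $ i > 0)}"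

definition edge_conductance ::
    "('n::finite \<times> 'n) set \<Rightarrow> ('n \<Rightarrow> 'n \<Rightarrow> real) \<Rightarrow> real ^ 'n \<Rightarrow> 'n \<Rightarrow> 'n \<Rightarrow> real" where
  "edge_conductance E \<omega> p i j =
     \<omega> i j * (1/2 * (p $ i / degree_dist E \<omega> i + p $ j / degree_dist E \<omega> j))"

definition laplacian ::
    "('n::finite \<times> 'n) set \<Rightarrow> ('n \<Rightarrow> 'n \<Rightarrow> real) \<Rightarrow> real ^ 'n \<Rightarrow> real ^ 'n ^ 'n" where
  "laplacian E \<omega> p =
     (\<chi> i j. if i = j then (\<Sum>k\<in>neighbors E i - {i}. edge_conductance E \<omega> p i k)
             else - edge_conductance E \<omega> p i j)"

lemma edge_conductance_sym:
  assumes "weighted_graph E \<omega>"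
  shows "edge_conductance E \<omega> p i j = edge_conductance E \<omega> p j i"
  using assms unfolding weighted_graph_def edge_conductance_def by (metis add.commute)

lemma transpose_laplacian:
  assumes "weighted_graph E \<omega>"
  shows "transpose (laplacian E \<omega> p) = laplacian E \<omega> p"
  using edge_conductance_sym[OF assms]
  by (simp add: transpose_def laplacian_def vec_eq_iff)

text \<open>The two lemmas \<open>transpose_laplacian\<close> and \<open>laplacian_quadratic_form\<close> characterise the
  Laplacian. Each undirected edge is counted twice in the sum over \<open>E\<close>, whence the factor
  \<open>1/2\<close>.\<close>

lemma laplacian_quadratic_form:
  assumes "weighted_graph E \<omega>"
  shows "\<Phi> \<bullet> (laplacian E \<omega> p *v \<Phi>) =
    1/2 * (\<Sum>(i, j)\<in>E. \<omega> i j * (\<Phi> $ i - \<Phi> $ j)\<^sup>2 *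
             (1/2 * (p $ i / degree_dist E \<omega> i + p $ j / degree_dist E \<omega> j)))"
proof -
  let ?c = "edge_conductance E \<omega> p"
  let ?x = "\<lambda>i. \<Phi> $ i"
  have c0: "?c i j = 0" if "(i, j) \<notin> E" for i j
    using assms that by (simp add: weighted_graph_def edge_conductance_def)
  have diag: "(\<Sum>k\<in>neighbors E i - {i}. ?c i k) = (\<Sum>k\<in>UNIV - {i}. ?c i k)" for i
    by (rule sum.mono_neutral_left) (use c0 in \<open>auto simp: neighbors_def\<close>)
  have row: "(laplacian E \<omega> p *v \<Phi>) $ i = (\<Sum>j\<in>UNIV. ?c i j * (?x i - ?x j))" for i
  proof -
    have "(laplacian E \<omega> p *v \<Phi>) $ i = (\<Sum>j\<in>UNIV. laplacian E \<omega> p $ i $ j * ?x j)"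
      by (simp add: matrix_vector_mult_def)
    also have "\<dots> = laplacian E \<omega> p $ i $ i * ?x i
        + (\<Sum>j\<in>UNIV - {i}. laplacian E \<omega> p $ i $ j * ?x j)"
      by (rule sum.remove) auto
    also have "(\<Sum>j\<in>UNIV - {i}. laplacian E \<omega> p $ i $ j * ?x j)
        = (\<Sum>j\<in>UNIV - {i}. - ?c i j * ?x j)"
      by (rule sum.cong) (auto simp: laplacian_def)
    also have "laplacian E \<omega> p $ i $ i * ?x i = (\<Sum>j\<in>UNIV - {i}. ?c i j * ?x i)"
      by (simp add: laplacian_def diag sum_distrib_right)
    also have "(\<Sum>j\<in>UNIV - {i}. ?c i j * ?x i) + (\<Sum>j\<in>UNIV - {i}. - ?c i j * ?x j)
        = (\<Sum>j\<in>UNIV - {i}. ?c i j * (?x i - ?x j))"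
      by (simp add: sum.distrib[symmetric] algebra_simps)
    also have "\<dots> = (\<Sum>j\<in>UNIV. ?c i j * (?x i - ?x j))"
      by (rule sum.mono_neutral_left) auto
    finally show ?thesis .
  qed
  have A: "\<Phi> \<bullet> (laplacian E \<omega> p *v \<Phi>) = (\<Sum>i\<in>UNIV. \<Sum>j\<in>UNIV. ?c i j * (?x i * (?x i - ?x j)))"
    by (simp add: inner_vec_def row sum_distrib_left algebra_simps)
  also have B: "\<dots> = (\<Sum>i\<in>UNIV. \<Sum>j\<in>UNIV. ?c i j * (?x j * (?x j - ?x i)))"
    by (subst sum.swap) (simp add: edge_conductance_sym[OF assms, of p])
  finally have "2 * (\<Phi> \<bullet> (laplacian E \<omega> p *v \<Phi>)) =
      (\<Sum>i\<in>UNIV. \<Sum>j\<in>UNIV. ?c i j * (?x i * (?x i - ?x j)))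
    + (\<Sum>i\<in>UNIV. \<Sum>j\<in>UNIV. ?c i j * (?x j * (?x j - ?x i)))"
    using A B by linarith
  also have "\<dots> = (\<Sum>i\<in>UNIV. \<Sum>j\<in>UNIV. ?c i j * (?x i - ?x j)\<^sup>2)"
    by (simp add: sum.distrib[symmetric] algebra_simps power2_eq_square)
  also have "\<dots> = (\<Sum>(i, j)\<in>UNIV. ?c i j * (?x i - ?x j)\<^sup>2)"
    by (simp add: sum.cartesian_product)
  also have "\<dots> = (\<Sum>(i, j)\<in>E. ?c i j * (?x i - ?x j)\<^sup>2)"
    by (rule sum.mono_neutral_right) (use c0 in auto)
  finally show ?thesis
    by (simp add: edge_conductance_def mult_ac)
qed

section \<open>The pseudo-inverse\<close>

definition is_pinv :: "real ^ 'n ^ 'm \<Rightarrow> real ^ 'm ^ 'n \<Rightarrow> bool" where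
  "is_pinv A X \<longleftrightarrow>
     A ** X ** A = A \<and> X ** A ** X = X \<and>
     transpose (A ** X) = A ** X \<and> transpose (X ** A) = X ** A"

lemma is_pinv_unique:
  assumes X: "is_pinv A X" and Y: "is_pinv A Y"
  shows "X = Y"
proof -
  have "A ** X = transpose (A ** X)" using X by (simp add: is_pinv_def)
  also have "\<dots> = transpose ((A ** Y) ** (A ** X))"
    using Y by (simp add: is_pinv_def matrix_mul_assoc)
  also have "\<dots> = transpose (A ** X) ** transpose (A ** Y)"
    by (rule matrix_transpose_mul)
  also have "\<dots> = A ** Y"
    using X Y by (simp add: is_pinv_def matrix_mul_assoc)
  finally have 1: "A ** X = A ** Y" .
  have "X ** A = transpose (X ** A)" using X by (simp add: is_pinv_def)
  also have "\<dots> = transpose ((X ** A) ** (Y ** A))"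
    using Y by (metis is_pinv_def matrix_mul_assoc)
  also have "\<dots> = transpose (Y ** A) ** transpose (X ** A)"
    by (rule matrix_transpose_mul)
  also have "\<dots> = Y ** A"
    using X Y by (metis is_pinv_def matrix_mul_assoc)
  finally have 2: "X ** A = Y ** A" .
  show ?thesis
    using X Y 1 2 by (metis is_pinv_def matrix_mul_assoc)
qed

definition pinv :: "real ^ 'n ^ 'm \<Rightarrow> real ^ 'm ^ 'n" where
  "pinv A = (THE X. is_pinv A X)"

lemma pinv_eqI: "is_pinv A X \<Longrightarrow> pinv A = X"
  unfolding pinv_def using is_pinv_unique by blast

section \<open>Parametrized models and the Wasserstein metric\<close>

text \<open>A map is \<open>C\<^sup>1\<close> on the parameter set \<open>\<Theta>\<close>, which need not be open, if it is \<open>C\<^sup>1\<close> on an open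
  neighbourhood \<open>U\<close> of \<open>\<Theta>\<close>. Values in the simplex are demanded on all of \<open>U\<close>, so that the columns
  of the Jacobi matrix are tangent to the simplex also where \<open>\<Theta>\<close> has empty interior.\<close>

definition statistical_model :: "(real ^ 'd) set \<Rightarrow> (real ^ 'd \<Rightarrow> real ^ 'n) \<Rightarrow> bool" where
  "statistical_model \<Theta> p \<longleftrightarrow>
     (\<exists>U. open U \<and> \<Theta> \<subseteq> U \<and> p ` U \<subseteq> pos_prob \<and>
          (\<forall>\<theta>\<in>U. p differentiable (at \<theta>)) \<and>
          continuous_on U (\<lambda>\<theta>. jacobian p (at \<theta>))) \<and>
     (\<forall>\<theta>\<in>\<Theta>. rank (jacobian p (at \<theta>)) = CARD('d))"

definition wasserstein_metric ::
    "('n::finite \<times> 'n) set \<Rightarrow> ('n \<Rightarrow> 'n \<Rightarrow> real) \<Rightarrow> (real ^ 'd \<Rightarrow> real ^ 'n) \<Rightarrow>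
     real ^ 'd \<Rightarrow> real ^ 'd ^ 'd" where
  "wasserstein_metric E \<omega> p \<theta> =
     transpose (jacobian p (at \<theta>)) ** pinv (laplacian E \<omega> (p \<theta>)) ** jacobian p (at \<theta>)"

definition C1_curves :: "(real ^ 'd) set \<Rightarrow> real ^ 'd \<Rightarrow> real ^ 'd \<Rightarrow> (real \<Rightarrow> real ^ 'd) set" where
  "C1_curves \<Theta> \<theta>0 \<theta>1 =
     {\<theta>. \<theta> C1_differentiable_on {0..1} \<and> \<theta> ` {0..1} \<subseteq> \<Theta> \<and> \<theta> 0 = \<theta>0 \<and> \<theta> 1 = \<theta>1}"

definition wasserstein_energy ::
    "('n::finite \<times> 'n) set \<Rightarrow> ('n \<Rightarrow> 'n \<Rightarrow> real) \<Rightarrow> (real ^ 'd \<Rightarrow> real ^ 'n) \<Rightarrow>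
     (real \<Rightarrow> real ^ 'd) \<Rightarrow> real" where
  "wasserstein_energy E \<omega> p \<theta> =
     integral {0..1} (\<lambda>t. vector_derivative \<theta> (at t) \<bullet>
                          (wasserstein_metric E \<omega> p (\<theta> t) *v vector_derivative \<theta> (at t)))"

text \<open>The value is meaningful only if \<open>\<theta>0\<close> and \<open>\<theta>1\<close> are joined by a \<open>C\<^sup>1\<close> curve in \<open>\<Theta>\<close>;
  otherwise it is the infimum of the empty set of reals.\<close>

definition wasserstein_dist ::
    "('n::finite \<times> 'n) set \<Rightarrow> ('n \<Rightarrow> 'n \<Rightarrow> real) \<Rightarrow> (real ^ 'd) set \<Rightarrow>
     (real ^ 'd \<Rightarrow> real ^ 'n) \<Rightarrow> real ^ 'd \<Rightarrow> real ^ 'd \<Rightarrow> real" where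
  "wasserstein_dist E \<omega> \<Theta> p \<theta>0 \<theta>1 =
     sqrt (INF \<theta>\<in>C1_curves \<Theta> \<theta>0 \<theta>1. wasserstein_energy E \<omega> p \<theta>)"

text \<open>For a connected Riemannian manifold the following holds automatically: the distance is finite
  and compatible with the topology. A compact \<open>\<Theta>\<close> in Euclidean space necessarily has a boundary;
  instead of a boundary regularity condition only this consequence is required.\<close>

definition riemannian_parameter_space ::
    "('n::finite \<times> 'n) set \<Rightarrow> ('n \<Rightarrow> 'n \<Rightarrow> real) \<Rightarrow> (real ^ 'd) set \<Rightarrow>
     (real ^ 'd \<Rightarrow> real ^ 'n) \<Rightarrow> bool" where
  "riemannian_parameter_space E \<omega> \<Theta> p \<longleftrightarrow>
     (\<forall>\<theta>0\<in>\<Theta>. \<forall>\<theta>1\<in>\<Theta>. C1_curves \<Theta> \<theta>0 \<theta>1 \<noteq> {}) \<and>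
     (\<forall>\<theta>0\<in>\<Theta>. continuous_on \<Theta> (wasserstein_dist E \<omega> \<Theta> p \<theta>0))"

definition constant_speed_geodesic ::
    "('n::finite \<times> 'n) set \<Rightarrow> ('n \<Rightarrow> 'n \<Rightarrow> real) \<Rightarrow> (real ^ 'd) set \<Rightarrow>
     (real ^ 'd \<Rightarrow> real ^ 'n) \<Rightarrow> (real \<Rightarrow> real ^ 'd) \<Rightarrow> bool" where
  "constant_speed_geodesic E \<omega> \<Theta> p \<theta> \<longleftrightarrow>
     \<theta> ` {0..1} \<subseteq> \<Theta> \<and>
     (\<forall>s\<in>{0..1}. \<forall>t\<in>{0..1}.
        wasserstein_dist E \<omega> \<Theta> p (\<theta> s) (\<theta> t) =
        \<bar>s - t\<bar> * wasserstein_dist E \<omega> \<Theta> p (\<theta> 0) (\<theta> 1))"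

section \<open>Divergence, curvature and the Fokker-Planck equation\<close>

definition KL :: "real ^ 'n \<Rightarrow> real ^ 'n \<Rightarrow> real" where
  "KL p q = (\<Sum>i\<in>UNIV. p $ i * ln (p $ i / q $ i))"

definition ricci_ge ::
    "('n::finite \<times> 'n) set \<Rightarrow> ('n \<Rightarrow> 'n \<Rightarrow> real) \<Rightarrow> (real ^ 'd) set \<Rightarrow>
     (real ^ 'd \<Rightarrow> real ^ 'n) \<Rightarrow> real ^ 'n \<Rightarrow> real \<Rightarrow> bool" where
  "ricci_ge E \<omega> \<Theta> p q \<kappa> \<longleftrightarrow>
     (\<forall>\<theta>. constant_speed_geodesic E \<omega> \<Theta> p \<theta> \<longrightarrow>
        (\<forall>t\<in>{0..1}.
           KL (p (\<theta> t)) q \<le> (1 - t) * KL (p (\<theta> 0)) q + t * KL (p (\<theta> 1)) q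
             - \<kappa> / 2 * t * (1 - t) * (wasserstein_dist E \<omega> \<Theta> p (\<theta> 0) (\<theta> 1))\<^sup>2))"

definition fp_field ::
    "('n::finite \<times> 'n) set \<Rightarrow> ('n \<Rightarrow> 'n \<Rightarrow> real) \<Rightarrow> (real ^ 'd \<Rightarrow> real ^ 'n) \<Rightarrow>
     real ^ 'n \<Rightarrow> real ^ 'd \<Rightarrow> real ^ 'd" where
  "fp_field E \<omega> p q \<theta> =
     - (pinv (wasserstein_metric E \<omega> p \<theta>) *v
        (transpose (jacobian p (at \<theta>)) *v (\<chi> i. ln (p \<theta> $ i / q $ i))))"

definition fp_equilibrium ::
    "('n::finite \<times> 'n) set \<Rightarrow> ('n \<Rightarrow> 'n \<Rightarrow> real) \<Rightarrow> (real ^ 'd) set \<Rightarrow>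
     (real ^ 'd \<Rightarrow> real ^ 'n) \<Rightarrow> real ^ 'n \<Rightarrow> real ^ 'd \<Rightarrow> bool" where
  "fp_equilibrium E \<omega> \<Theta> p q \<theta> \<longleftrightarrow> \<theta> \<in> \<Theta> \<and> fp_field E \<omega> p q \<theta> = 0"

definition fp_solution ::
    "('n::finite \<times> 'n) set \<Rightarrow> ('n \<Rightarrow> 'n \<Rightarrow> real) \<Rightarrow> (real ^ 'd) set \<Rightarrow>
     (real ^ 'd \<Rightarrow> real ^ 'n) \<Rightarrow> real ^ 'n \<Rightarrow> real ^ 'd \<Rightarrow> (real \<Rightarrow> real ^ 'd) \<Rightarrow> bool" where
  "fp_solution E \<omega> \<Theta> p q \<theta>0 \<theta> \<longleftrightarrow>
     \<theta> 0 = \<theta>0 \<and>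
     (\<forall>t\<ge>0. \<theta> t \<in> \<Theta> \<and>
        (\<theta> has_vector_derivative fp_field E \<omega> p q (\<theta> t)) (at t within {0..}))"

end

theory Submission
  imports Defs "HOL-Complex_Analysis.Great_Picard" "HOL-Real_Asymp.Real_Asymp"
begin

text \<open>
  Write \<open>F x = D(p(x) | q)\<close> and let \<open>d\<close> be the Wasserstein distance. Since \<open>\<Theta>\<close> is compact, any
  two of its points are joined by a minimizing geodesic, a limit of curves of nearly minimal
  energy. Comparing the \<open>\<kappa>\<close>-convexity of \<open>F\<close> along a geodesic from \<open>x\<close> to \<open>y\<close> with the first-order
  decrease of \<open>F\<close> at \<open>x\<close> yields the Polyak-Lojasiewicz inequality
  \<open>2\<kappa> (F x - F y) \<le> |grad F(x)|\<^sup>2\<close>, the norm being that of the Wasserstein metric. Hence stationary points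
  are minimizers, and Gronwall's inequality gives the decay rate along the flow. Convexity along
  geodesics from a minimizer \<open>m\<close> gives \<open>\<kappa>/2 d(m, x)\<^sup>2 \<le> F x - F m\<close>, whence uniqueness of \<open>m\<close> and
  exponential convergence to it.
\<close>

section \<open>Matrices depending continuously on a parameter\<close>

text \<open>Since \<open>\<Theta>\<close> may have a boundary, a geodesic need not solve an ODE, and
  as a uniform limit of curves it need not be differentiable at all. So nothing is ever
  differentiated along a geodesic: inequalities are proved on near-optimal C^1 curves and reach
  geodesics only through the distance, whose continuity is part of
  \<open>riemannian_parameter_space\<close>. As the distance is an infimum of energies rather than
  of lengths, Young's inequality with a free time scale takes the place of Cauchy-Schwarz. The
  heuristic behind the central inequality: with \<open>D = d(x, y)\<close> and
  \<open>g = |grad F(x)|\<close>, convexity near x gives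
  \<open>F x - F y + \<kappa>/2 D^2 <= g D\<close>, and
  \<open>g D <= g^2 / (2\<kappa>) + \<kappa>/2 D^2\<close>. The two terms in D cancel, which leaves
  the constant \<open>2\<kappa>\<close>.\<close>

lemma inner_matrix_symmetric:
  fixes A :: "real ^ 'n ^ 'n"
  assumes "transpose A = A"
  shows "v \<bullet> (A *v w) = w \<bullet> (A *v v)"
  by (metis assms dot_lmul_matrix inner_commute transpose_matrix_vector)

lemma positive_definite_invertible:
  fixes A :: "real ^ 'n ^ 'n"
  assumes "\<And>v. v \<noteq> 0 \<Longrightarrow> 0 < v \<bullet> (A *v v)"
  shows "invertible A"
  using assms unfolding invertible_left_inverse matrix_left_invertible_ker
  by (metis inner_zero_right less_irrefl)

lemma matrix_inv_mult:
  fixes A :: "real ^ 'n ^ 'n"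
  assumes "invertible A"
  shows "A ** matrix_inv A = mat 1" and "matrix_inv A ** A = mat 1"
proof -
  have "A ** matrix_inv A = mat 1 \<and> matrix_inv A ** A = mat 1"
    using assms unfolding invertible_def matrix_inv_def by (rule someI_ex)
  then show "A ** matrix_inv A = mat 1" "matrix_inv A ** A = mat 1" by auto
qed

lemma transpose_matrix_inv:
  fixes A :: "real ^ 'n ^ 'n"
  assumes "invertible A" "transpose A = A"
  shows "transpose (matrix_inv A) = matrix_inv A"
proof -
  have "transpose (matrix_inv A) ** A = mat 1"
    using matrix_transpose_mul[of A "matrix_inv A"] assms by (simp add: matrix_inv_mult)
  then show ?thesis
    using matrix_inv_mult[OF assms(1)] by (metis matrix_mul_assoc matrix_mul_lid matrix_mul_rid)
qed

lemma pinv_invertible: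
  fixes A :: "real ^ 'n ^ 'n"
  assumes "invertible A"
  shows "pinv A = matrix_inv A"
  using matrix_inv_mult[OF assms] by (intro pinv_eqI) (simp add: is_pinv_def)

lemma continuous_on_matrix_entries:
  fixes A :: "'a :: topological_space \<Rightarrow> real ^ 'n ^ 'm"
  assumes "\<And>i j. continuous_on S (\<lambda>x. A x $ i $ j)"
  shows "continuous_on S A"
proof -
  have "continuous_on S (\<lambda>x. \<chi> i. \<chi> j. A x $ i $ j)"
    by (intro continuous_on_vec_lambda assms)
  then show ?thesis by simp
qed

lemma continuous_on_matrix_mult:
  fixes A :: "'a :: topological_space \<Rightarrow> real ^ 'n ^ 'm" and B :: "'a \<Rightarrow> real ^ 'k ^ 'n"
  assumes "continuous_on S A" "continuous_on S B"
  shows "continuous_on S (\<lambda>x. A x ** B x)"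
  unfolding matrix_matrix_mult_def
  by (intro continuous_on_vec_lambda continuous_intros assms)

lemma continuous_on_matrix_vector_mult:
  fixes A :: "'a :: topological_space \<Rightarrow> real ^ 'n ^ 'm" and v :: "'a \<Rightarrow> real ^ 'n"
  assumes "continuous_on S A" "continuous_on S v"
  shows "continuous_on S (\<lambda>x. A x *v v x)"
  unfolding matrix_vector_mult_def
  by (intro continuous_on_vec_lambda continuous_intros assms)

lemma continuous_on_transpose:
  fixes A :: "'a :: topological_space \<Rightarrow> real ^ 'n ^ 'm"
  assumes "continuous_on S A"
  shows "continuous_on S (\<lambda>x. transpose (A x))"
  unfolding transpose_def
  by (intro continuous_on_vec_lambda continuous_intros assms)

lemma continuous_on_det:
  fixes A :: "'a :: topological_space \<Rightarrow> real ^ 'n ^ 'n"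
  assumes "continuous_on S A"
  shows "continuous_on S (\<lambda>x. det (A x))"
  unfolding det_def by (intro continuous_intros assms)

text \<open>By Cramer's rule each entry of the inverse is a quotient of determinants with
  nonvanishing denominator; \<open>?C\<close> is \<open>A\<close> with column \<open>i\<close>
  replaced by the unit vector of index \<open>j\<close>.\<close>

lemma continuous_on_matrix_inv:
  fixes A :: "'a :: topological_space \<Rightarrow> real ^ 'n ^ 'n"
  assumes A: "continuous_on S A" and inv: "\<And>x. x \<in> S \<Longrightarrow> invertible (A x)"
  shows "continuous_on S (\<lambda>x. matrix_inv (A x))"
proof (rule continuous_on_matrix_entries)
  fix i j :: 'n
  let ?b = "axis j (1::real) :: real ^ 'n"
  let ?C = "\<lambda>x. (\<chi> k l. if l = i then ?b $ k else A x $ k $ l) :: real ^ 'n ^ 'n"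
  have eq: "matrix_inv (A x) $ i $ j = det (?C x) / det (A x)" if "x \<in> S" for x
  proof -
    have d: "det (A x) \<noteq> 0"
      using inv[OF that] by (simp add: invertible_det_nz)
    have "A x *v (matrix_inv (A x) *v ?b) = ?b"
      using inv[OF that] by (simp add: matrix_vector_mul_assoc matrix_inv_mult)
    then have "(matrix_inv (A x) *v ?b) $ i = det (?C x) / det (A x)"
      unfolding cramer[OF d] by simp
    then show ?thesis
      by (simp add: matrix_vector_mult_basis column_def)
  qed
  have "continuous_on S ?C"
  proof (intro continuous_on_vec_lambda)
    show "continuous_on S (\<lambda>x. if l = i then ?b $ k else A x $ k $ l)" for k l
      by (cases "l = i") (simp_all add: continuous_on_component A)
  qed
  then have "continuous_on S (\<lambda>x. det (?C x) / det (A x))"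
    using inv by (intro continuous_on_divide continuous_on_det A) (simp_all add: invertible_det_nz)
  then show "continuous_on S (\<lambda>x. matrix_inv (A x) $ i $ j)"
    using eq by (simp cong: continuous_on_cong)
qed

section \<open>The pseudo-inverse of the graph Laplacian\<close>

text \<open>The orthogonal projection onto the constant vectors, which form the kernel of the
  Laplacian of a connected graph.\<close>

definition mean_matrix :: "real ^ 'n ^ 'n" where
  "mean_matrix = (\<chi> i j. 1 / real CARD('n))"

lemma mean_matrix_mult_vector:
  "(mean_matrix :: real ^ 'n ^ 'n) *v v = (\<chi> i. (\<Sum>j\<in>UNIV. v $ j) / real CARD('n))"
  by (simp add: mean_matrix_def matrix_vector_mult_def sum_divide_distrib)

lemma transpose_mean_matrix: "transpose mean_matrix = mean_matrix"
  by (simp add: mean_matrix_def transpose_def)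

lemma mean_matrix_idem: "mean_matrix ** mean_matrix = (mean_matrix :: real ^ 'n ^ 'n)"
  by (simp add: mean_matrix_def matrix_matrix_mult_def vec_eq_iff)

lemma matrix_mult_add_left: "(A + B) ** C = A ** C + B ** (C :: real ^ 'k ^ 'n)"
  by (simp add: matrix_matrix_mult_def vec_eq_iff sum.distrib algebra_simps)

lemma matrix_mult_diff_left: "(A - B) ** C = A ** C - B ** (C :: real ^ 'k ^ 'n)"
  by (simp add: matrix_matrix_mult_def vec_eq_iff sum_subtractf algebra_simps)

lemma matrix_mult_diff_right: "A ** (B - C) = A ** B - A ** (C :: real ^ 'k ^ 'n)"
  by (simp add: matrix_matrix_mult_def vec_eq_iff sum_subtractf algebra_simps)

text \<open>Adding the projection \<open>P\<close> onto constants makes \<open>L\<close> invertible;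
  the inverse fixes constants, and subtracting \<open>P\<close> removes that part again. The formula
  reduces continuity and positivity of the pseudo-inverse to those of a true inverse.\<close>

lemma pinv_eq_inverse_minus_mean:
  fixes L :: "real ^ 'n ^ 'n"
  assumes sym: "transpose L = L" and const: "L ** mean_matrix = 0"
    and inv: "invertible (L + mean_matrix)"
  shows "pinv L = matrix_inv (L + mean_matrix) - mean_matrix"
proof (rule pinv_eqI)
  define P :: "real ^ 'n ^ 'n" where "P = mean_matrix"
  define N where "N = matrix_inv (L + P)"
  have symP: "transpose P = P" and PP: "P ** P = P" and LP: "L ** P = 0"
    using const by (simp_all add: P_def transpose_mean_matrix mean_matrix_idem)
  have PL: "P ** L = 0"
    using matrix_transpose_mul[of L P] unfolding LP sym symP by (simp add: transpose_def zero_vec_def flip: vec_eq_iff)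
  have MN: "(L + P) ** N = mat 1" and NM: "N ** (L + P) = mat 1"
    using inv by (simp_all add: N_def P_def matrix_inv_mult)
  have MP: "(L + P) ** P = P"
    by (simp add: matrix_mult_add_left LP PP)
  have PM: "P ** (L + P) = P"
    by (simp add: matrix_add_ldistrib PL PP)
  have NP: "N ** P = P"
    using MP NM by (metis matrix_mul_assoc matrix_mul_lid)
  have PN: "P ** N = P"
    using PM MN by (metis matrix_mul_assoc matrix_mul_rid)
  have LN: "L ** N = mat 1 - P"
    using MN by (simp add: matrix_mult_add_left PN algebra_simps)
  have NL: "N ** L = mat 1 - P"
    using NM by (simp add: matrix_add_ldistrib NP algebra_simps)
  \<comment> \<open>Both products are the projection onto vectors of sum zero, so the Penrose
    equations reduce to its symmetry and to its annihilating constants.\<close>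
  have LX: "L ** (N - P) = mat 1 - P" and XL: "(N - P) ** L = mat 1 - P"
    by (simp_all add: matrix_mult_diff_left matrix_mult_diff_right LN NL LP PL)
  have "transpose (mat 1 - P) = mat 1 - P"
    using symP by (simp add: transpose_def vec_eq_iff mat_def)
  then have "is_pinv L (N - P)"
    unfolding is_pinv_def LX XL
    by (simp add: matrix_mult_diff_left matrix_mult_diff_right PL PN PP)
  then show "is_pinv L (matrix_inv (L + mean_matrix) - mean_matrix)"
    by (simp add: N_def P_def)
qed

section \<open>Kernel and positivity of the graph Laplacian\<close>

lemma degree_dist_pos:
  assumes graph: "weighted_graph E \<omega>" and two: "CARD('n::finite) \<ge> 2"
  shows "degree_dist E \<omega> (i::'n) > 0"
proof -
  have pos: "(\<Sum>j\<in>neighbors E k. \<omega> k j) > 0" for k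
  proof -
    have "\<exists>l. l \<noteq> k"
    proof (rule ccontr)
      assume "\<nexists>l. l \<noteq> k"
      then have "(UNIV :: 'n set) = {k}" by auto
      then have "CARD('n) = card {k}" by presburger
      then show False using two by simp
    qed
    then obtain l where "l \<noteq> k" by blast
    \<comment> \<open>The first step of a path from \<open>k\<close> to a different vertex is an
      edge at \<open>k\<close>. A single vertex without a loop would have degree 0/0.\<close>
    have "(k, l) \<in> E\<^sup>*" using graph by (simp add: weighted_graph_def)
    with \<open>l \<noteq> k\<close> obtain m where "(k, m) \<in> E" by (metis converse_rtranclE)
    then show ?thesis
    proof (intro sum_pos)
      show "neighbors E k \<noteq> {}"
        using \<open>(k, m) \<in> E\<close> by (auto simp: neighbors_def)
      show "0 < \<omega> k j" if "j \<in> neighbors E k" for j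
        using graph that unfolding neighbors_def weighted_graph_def mem_Collect_eq by blast
    qed simp
  qed
  show ?thesis
    unfolding degree_dist_def by (intro divide_pos_pos sum_pos pos) auto
qed

text \<open>Every row of the Laplacian sums to zero, so constants lie in its kernel.\<close>

lemma laplacian_mean_matrix:
  assumes graph: "weighted_graph E \<omega>"
  shows "laplacian E \<omega> p ** mean_matrix = (0 :: real ^ 'n ^ 'n)"
proof -
  have "(\<Sum>k\<in>UNIV. laplacian E \<omega> p $ i $ k) = 0" for i
  proof -
    have "(\<Sum>k\<in>UNIV. laplacian E \<omega> p $ i $ k)
        = laplacian E \<omega> p $ i $ i + (\<Sum>k\<in>UNIV - {i}. laplacian E \<omega> p $ i $ k)"
      by (rule sum.remove) auto
    also have "(\<Sum>k\<in>UNIV - {i}. laplacian E \<omega> p $ i $ k)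
        = - (\<Sum>k\<in>UNIV - {i}. edge_conductance E \<omega> p i k)"
      unfolding sum_negf[symmetric] by (rule sum.cong) (auto simp: laplacian_def)
    also have "(\<Sum>k\<in>UNIV - {i}. edge_conductance E \<omega> p i k)
        = (\<Sum>k\<in>neighbors E i - {i}. edge_conductance E \<omega> p i k)"
    proof (rule sum.mono_neutral_right)
      have "\<omega> i k = 0" if "(i, k) \<notin> E" for k
        using graph that unfolding weighted_graph_def by blast
      then show "\<forall>k\<in>UNIV - {i} - (neighbors E i - {i}). edge_conductance E \<omega> p i k = 0"
        by (auto simp: neighbors_def edge_conductance_def)
    qed auto
    finally show ?thesis by (simp add: laplacian_def)
  qed
  then show ?thesis
    by (simp add: mean_matrix_def matrix_matrix_mult_def vec_eq_iff flip: sum_divide_distrib)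
qed

text \<open>The form is a Dirichlet sum over the edges plus the squared sum of the entries divided
  by their number. If both vanish, \<open>v\<close> agrees along edges, hence is constant by
  connectedness, and its sum is zero.\<close>

lemma laplacian_plus_mean_pos:
  fixes v :: "real ^ 'n"
  assumes graph: "weighted_graph E \<omega>" and two: "CARD('n) \<ge> 2"
    and p: "p \<in> pos_prob" and v: "v \<noteq> 0"
  shows "0 < v \<bullet> ((laplacian E \<omega> p + mean_matrix) *v v)"
proof -
  let ?s = "\<Sum>j\<in>UNIV. v $ j"
  let ?t = "\<lambda>i j. \<omega> i j * (v $ i - v $ j)\<^sup>2 *
      (1/2 * (p $ i / degree_dist E \<omega> i + p $ j / degree_dist E \<omega> j))"
  have c: "\<omega> i j > 0" "1/2 * (p $ i / degree_dist E \<omega> i + p $ j / degree_dist E \<omega> j) > 0"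
    if "(i, j) \<in> E" for i j
    using graph that p degree_dist_pos[OF graph two]
    by (auto simp: weighted_graph_def pos_prob_def intro!: add_pos_pos)
  have t: "0 \<le> ?t i j" if "(i, j) \<in> E" for i j
    using c[OF that] by (intro mult_nonneg_nonneg) auto
  have mean: "v \<bullet> (mean_matrix *v v) = ?s\<^sup>2 / real CARD('n)"
    by (simp add: mean_matrix_mult_vector inner_vec_def power2_eq_square
        flip: sum_divide_distrib sum_distrib_right)
  have lap: "v \<bullet> (laplacian E \<omega> p *v v) = 1/2 * (\<Sum>(i, j)\<in>E. ?t i j)"
    by (rule laplacian_quadratic_form[OF graph])
  have lap0: "0 \<le> (\<Sum>(i, j)\<in>E. ?t i j)"
    using t by (intro sum_nonneg) auto
  have split: "v \<bullet> ((laplacian E \<omega> p + mean_matrix) *v v)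
      = 1/2 * (\<Sum>(i, j)\<in>E. ?t i j) + ?s\<^sup>2 / real CARD('n)"
    by (simp add: matrix_vector_mult_add_rdistrib inner_add_right lap mean)
  show ?thesis
  proof (rule ccontr)
    assume "\<not> ?thesis"
    then have le: "1/2 * (\<Sum>(i, j)\<in>E. ?t i j) + ?s\<^sup>2 / real CARD('n) \<le> 0"
      unfolding split by simp
    moreover have "0 \<le> ?s\<^sup>2 / real CARD('n)" by simp
    ultimately have "(\<Sum>(i, j)\<in>E. ?t i j) = 0" and "?s\<^sup>2 / real CARD('n) = 0"
      using lap0 by linarith+
    then have S: "(\<Sum>(i, j)\<in>E. ?t i j) = 0" and s: "?s = 0"
      by (blast, simp)
    have "0 \<le> (case e of (i, j) \<Rightarrow> ?t i j)" if "e \<in> E" for e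
      using that t by (cases e) (simp only: prod.case)
    with S have z: "\<forall>e\<in>E. (case e of (i, j) \<Rightarrow> ?t i j) = 0"
      using sum_nonneg_eq_0_iff[OF finite] by blast
    have edge: "v $ i = v $ j" if "(i, j) \<in> E" for i j
    proof -
      have "?t i j = 0" using bspec[OF z that] by (simp only: prod.case)
      then have "(v $ i - v $ j)\<^sup>2 = 0"
        using c[OF that] by (metis less_irrefl mult_eq_0_iff)
      then show ?thesis by simp
    qed
    have const: "v $ i = v $ j" for i j
    proof -
      have "(i, j) \<in> E\<^sup>*" using graph by (simp add: weighted_graph_def)
      then show ?thesis by (induction rule: rtrancl_induct) (auto dest: edge)
    qed
    have "?s = (\<Sum>j\<in>(UNIV :: 'n set). v $ i)" for i
      by (intro sum.cong refl const)
    with s have "v = 0" by (simp add: vec_eq_iff)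
    with v show False ..
  qed
qed

lemma pinv_laplacian:
  fixes p :: "real ^ 'n"
  assumes graph: "weighted_graph E \<omega>" and two: "CARD('n) \<ge> 2" and p: "p \<in> pos_prob"
  shows "pinv (laplacian E \<omega> p) = matrix_inv (laplacian E \<omega> p + mean_matrix) - mean_matrix"
    and "invertible (laplacian E \<omega> p + mean_matrix)"
    and "transpose (pinv (laplacian E \<omega> p)) = pinv (laplacian E \<omega> p)"
    and "(\<Sum>i\<in>UNIV. v $ i) = 0 \<Longrightarrow> v \<noteq> 0 \<Longrightarrow> 0 < v \<bullet> (pinv (laplacian E \<omega> p) *v v)"
proof -
  let ?M = "laplacian E \<omega> p + mean_matrix"
  let ?N = "matrix_inv ?M"
  show inv: "invertible ?M"
    using laplacian_plus_mean_pos[OF graph two p] by (rule positive_definite_invertible)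
  show eq: "pinv (laplacian E \<omega> p) = ?N - mean_matrix"
    by (rule pinv_eq_inverse_minus_mean[OF transpose_laplacian[OF graph]
          laplacian_mean_matrix[OF graph] inv])
  have "transpose ?M = ?M"
    using transpose_laplacian[OF graph, of p] transpose_mean_matrix
    by (simp add: transpose_def vec_eq_iff)
  with inv have "transpose ?N = ?N" by (rule transpose_matrix_inv)
  then show "transpose (pinv (laplacian E \<omega> p)) = pinv (laplacian E \<omega> p)"
    using transpose_mean_matrix unfolding eq by (simp add: transpose_def vec_eq_iff)
  assume s: "(\<Sum>i\<in>UNIV. v $ i) = 0" and v: "v \<noteq> 0"
  \<comment> \<open>With \<open>v = ?M *v ?u\<close>, the form of the inverse at \<open>v\<close>
    equals the form of \<open>?M\<close> at \<open>?u\<close>. On vectors of sum zero the inverse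
    and the pseudo-inverse agree.\<close>
  let ?u = "?N *v v"
  have v_eq: "v = ?M *v ?u"
    using inv by (simp add: matrix_vector_mul_assoc matrix_inv_mult)
  then have "?u \<noteq> 0" using v by auto
  then have "0 < ?u \<bullet> (?M *v ?u)"
    by (rule laplacian_plus_mean_pos[OF graph two p])
  also have "\<dots> = v \<bullet> ?u"
    unfolding v_eq[symmetric] by (rule inner_commute)
  also have "?u = pinv (laplacian E \<omega> p) *v v"
    by (simp add: eq matrix_vector_mult_diff_rdistrib mean_matrix_mult_vector s vec_eq_iff)
  finally show "0 < v \<bullet> (pinv (laplacian E \<omega> p) *v v)" .
qed

text \<open>A pseudo-inverse is discontinuous where the rank jumps. Here the kernel consists of the
  constants for every strictly positive distribution, so the closed formula applies
  throughout.\<close>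

lemma continuous_on_pinv_laplacian:
  fixes p :: "'a :: topological_space \<Rightarrow> real ^ 'n"
  assumes graph: "weighted_graph E \<omega>" and two: "CARD('n) \<ge> 2"
    and p: "\<And>x. x \<in> S \<Longrightarrow> p x \<in> pos_prob" and cont: "continuous_on S p"
  shows "continuous_on S (\<lambda>x. pinv (laplacian E \<omega> (p x)))"
proof -
  have "continuous_on S (\<lambda>x. laplacian E \<omega> (p x))"
  proof (rule continuous_on_matrix_entries)
    fix i j
    show "continuous_on S (\<lambda>x. laplacian E \<omega> (p x) $ i $ j)"
      unfolding laplacian_def edge_conductance_def vec_lambda_beta divide_inverse
      by (cases "i = j"; simp only: refl if_True if_False; intro continuous_intros cont)
  qed
  then have "continuous_on S (\<lambda>x. matrix_inv (laplacian E \<omega> (p x) + mean_matrix) - mean_matrix)"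
    by (intro continuous_intros continuous_on_matrix_inv pinv_laplacian(2)[OF graph two] p)
  then show ?thesis
    using pinv_laplacian(1)[OF graph two p] by (simp cong: continuous_on_cong)
qed

section \<open>The distance of a continuous Riemannian metric on a compact set\<close>

text \<open>Energy and distance are restated for an arbitrary matrix field \<open>G\<close>, so that
  the geometry does not depend on the statistical model;
  \<open>wasserstein_dist_eq_curve_dist\<close> translates back.\<close>

definition curve_energy ::
    "(real ^ 'd \<Rightarrow> real ^ 'd ^ 'd) \<Rightarrow> (real \<Rightarrow> real ^ 'd) \<Rightarrow> real" where
  "curve_energy G \<sigma> =
     integral {0..1} (\<lambda>t. vector_derivative \<sigma> (at t) \<bullet> (G (\<sigma> t) *v vector_derivative \<sigma> (at t)))"

definition curve_dist ::
    "(real ^ 'd) set \<Rightarrow> (real ^ 'd \<Rightarrow> real ^ 'd ^ 'd) \<Rightarrow> real ^ 'd \<Rightarrow> real ^ 'd \<Rightarrow> real" where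
  "curve_dist \<Theta> G x y = sqrt (INF \<sigma>\<in>C1_curves \<Theta> x y. curve_energy G \<sigma>)"

text \<open>The fundamental theorem itself makes \<open>f'\<close> integrable. In this form
  pointwise Young inequalities are integrated along curves.\<close>

lemma derivative_le_imp_diff_le_integral:
  fixes f :: "real \<Rightarrow> real"
  assumes "a \<le> b" and f: "\<And>t. t \<in> {a..b} \<Longrightarrow> (f has_real_derivative f' t) (at t within {a..b})"
    and le: "\<And>t. t \<in> {a..b} \<Longrightarrow> f' t \<le> g t" and g: "g integrable_on {a..b}"
  shows "f b - f a \<le> integral {a..b} g"
proof -
  have "(f' has_integral (f b - f a)) {a..b}"
    using f by (intro fundamental_theorem_of_calculus \<open>a \<le> b\<close>)
      (simp add: has_real_derivative_iff_has_vector_derivative)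
  with le g show ?thesis
    by (intro has_integral_le[OF _ integrable_integral]) auto
qed

text \<open>A C^1 primitive of the ramp \<open>max 0\<close>, from which \<open>smooth_step\<close>
  is assembled.\<close>

lemma DERIV_half_positive_part_square:
  "((\<lambda>x::real. (max 0 x)\<^sup>2 / 2) has_real_derivative max 0 x) (at x)"
proof -
  consider "x < 0" | "x = 0" | "x > 0" by linarith
  then show ?thesis
  proof cases
    case 1
    have "((\<lambda>x::real. (max 0 x)\<^sup>2 / 2) has_real_derivative 0) (at x)"
      by (rule has_field_derivative_transform_within_open[where S = "{..<0}" and f = "\<lambda>_. 0"])
        (use 1 in auto)
    then show ?thesis using 1 by simp
  next
    case 2
    have "((\<lambda>h::real. (max 0 h)\<^sup>2 / 2 / h) \<longlongrightarrow> 0) (at 0)"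
    proof (rule Lim_null_comparison)
      show "\<forall>\<^sub>F h in at 0. norm ((max 0 h)\<^sup>2 / 2 / h) \<le> \<bar>h\<bar>"
        by (intro always_eventually allI) (auto simp: max_def power2_eq_square)
      show "((\<lambda>h::real. \<bar>h\<bar>) \<longlongrightarrow> 0) (at 0)"
        using tendsto_rabs_zero_iff by (auto intro!: tendsto_eq_intros)
    qed
    then show ?thesis
      using 2 by (simp add: DERIV_def)
  next
    case 3
    have "((\<lambda>x::real. x\<^sup>2 / 2) has_real_derivative x) (at x)"
      by (auto intro!: derivative_eq_intros)
    then have "((\<lambda>x::real. (max 0 x)\<^sup>2 / 2) has_real_derivative x) (at x)"
      by (rule has_field_derivative_transform_within_open[where S = "{0<..}"]) (use 3 in auto)
    then show ?thesis using 3 by simp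
  qed
qed

text \<open>The derivative of the step is a trapezoid of height \<open>c = 1 / (1 - \<delta>)\<close> whose slopes
  have width \<open>\<delta>\<close>.\<close>

lemma smooth_step:
  fixes c :: real
  assumes "c > 1"
  obtains \<phi> \<psi> :: "real \<Rightarrow> real"
  where "\<And>t. (\<phi> has_real_derivative \<psi> t) (at t)" and "continuous_on UNIV \<psi>"
    and "\<And>t. 0 \<le> \<psi> t" and "\<And>t. \<psi> t \<le> c"
    and "\<And>t. t \<le> 0 \<Longrightarrow> \<phi> t = 0" and "\<And>t. t \<ge> 1 \<Longrightarrow> \<phi> t = 1"
    and "\<And>t. t \<le> 0 \<or> t \<ge> 1 \<Longrightarrow> \<psi> t = 0" and "\<And>t. 0 \<le> \<phi> t \<and> \<phi> t \<le> 1"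
proof -
  define \<delta> where "\<delta> = 1 - 1 / c"
  have \<delta>: "0 < \<delta>" "\<delta> < 1" and c: "c * (1 - \<delta>) = 1" "0 < c"
    using assms by (auto simp: \<delta>_def)
  define r :: "real \<Rightarrow> real" where "r = max 0"
  define q :: "real \<Rightarrow> real" where "q = (\<lambda>t. (max 0 t)\<^sup>2 / 2)"
  \<comment> \<open>The four shifted ramps in \<psi> form the convolution of the indicators of
    \<open>[0, \<delta>]\<close> and \<open>[0, 1 - \<delta>]\<close>. Its mass is
    \<open>\<delta> * (1 - \<delta>)\<close>, which the factor \<open>c / \<delta>\<close>
    normalizes to 1.\<close>
  define \<phi> where "\<phi> = (\<lambda>t. c / \<delta> * (q t - q (t - \<delta>) - q (t - (1 - \<delta>)) + q (t - 1)))"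
  define \<psi> where "\<psi> = (\<lambda>t. c / \<delta> * (r t - r (t - \<delta>) - r (t - (1 - \<delta>)) + r (t - 1)))"
  have q: "((\<lambda>t. q (t - a)) has_real_derivative r (t - a)) (at t)" for a t
    using DERIV_shift[of q "r (t - a)" t "- a"] DERIV_half_positive_part_square[of "t - a"]
    by (simp add: q_def r_def)
  have d: "(\<phi> has_real_derivative \<psi> t) (at t)" for t
    unfolding \<phi>_def \<psi>_def using q[of 0 t]
    by (intro DERIV_cmult DERIV_add DERIV_diff q) simp
  have cont: "continuous_on UNIV \<psi>"
    unfolding \<psi>_def r_def by (intro continuous_intros)
  have pos: "0 \<le> \<psi> t" for t
    unfolding \<psi>_def using \<delta> c
    by (intro mult_nonneg_nonneg divide_nonneg_nonneg) (auto simp: r_def max_def)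
  have le: "\<psi> t \<le> c" for t
  proof -
    have "r t - r (t - \<delta>) - r (t - (1 - \<delta>)) + r (t - 1) \<le> \<delta>"
      using \<delta> by (auto simp: r_def max_def)
    then have "\<psi> t \<le> c / \<delta> * \<delta>"
      unfolding \<psi>_def using \<delta> c by (intro mult_left_mono) auto
    then show ?thesis using \<delta> by simp
  qed
  have z: "\<phi> t = 0" if "t \<le> 0" for t
    using that \<delta> by (simp add: \<phi>_def q_def max_def)
  have o: "\<phi> t = 1" if "t \<ge> 1" for t
  proof -
    have "q t - q (t - \<delta>) - q (t - (1 - \<delta>)) + q (t - 1) = \<delta> * (1 - \<delta>)"
      using that \<delta> by (simp add: q_def max_def power2_eq_square field_simps)
    then show ?thesis
      using \<delta> c by (simp add: \<phi>_def)
  qed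
  have \<psi>0: "\<psi> t = 0" if "t \<le> 0 \<or> t \<ge> 1" for t
    using that \<delta> by (auto simp: \<psi>_def r_def max_def)
  have mono: "\<phi> s \<le> \<phi> t" if "s \<le> t" for s t
    using d pos by (intro DERIV_nonneg_imp_nondecreasing[OF that]) blast
  have "0 \<le> \<phi> t \<and> \<phi> t \<le> 1" for t
    using mono[of "min t 0" t] mono[of t "max t 1"] z[of "min t 0"] o[of "max t 1"] by auto
  with d cont pos le z o \<psi>0 show ?thesis by (rule that)
qed

locale riemannian_region =
  fixes \<Theta> :: "(real ^ 'd) set" and G :: "real ^ 'd \<Rightarrow> real ^ 'd ^ 'd"
  assumes compact: "compact \<Theta>"
    and continuous_metric: "continuous_on \<Theta> G"
    and symmetric: "x \<in> \<Theta> \<Longrightarrow> transpose (G x) = G x"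
    and positive: "x \<in> \<Theta> \<Longrightarrow> v \<noteq> 0 \<Longrightarrow> 0 < v \<bullet> (G x *v v)"
    and curves: "x \<in> \<Theta> \<Longrightarrow> y \<in> \<Theta> \<Longrightarrow> C1_curves \<Theta> x y \<noteq> {}"
    and continuous_dist: "x \<in> \<Theta> \<Longrightarrow> continuous_on \<Theta> (curve_dist \<Theta> G x)"
begin

abbreviation energy :: "(real \<Rightarrow> real ^ 'd) \<Rightarrow> real" where
  "energy \<equiv> curve_energy G"

abbreviation d\<^sub>G :: "real ^ 'd \<Rightarrow> real ^ 'd \<Rightarrow> real" where
  "d\<^sub>G \<equiv> curve_dist \<Theta> G"

abbreviation vel :: "(real \<Rightarrow> real ^ 'd) \<Rightarrow> real \<Rightarrow> real ^ 'd" where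
  "vel \<sigma> t \<equiv> vector_derivative \<sigma> (at t)"

abbreviation density :: "(real \<Rightarrow> real ^ 'd) \<Rightarrow> real \<Rightarrow> real" where
  "density \<sigma> t \<equiv> vel \<sigma> t \<bullet> (G (\<sigma> t) *v vel \<sigma> t)"

text \<open>The derivative in \<open>C1_differentiable_on\<close> is two-sided, so a curve also has
  values just outside the unit interval; only those inside are constrained to
  \<open>\<Theta>\<close>.\<close>

definition C1_path :: "(real \<Rightarrow> real ^ 'd) \<Rightarrow> bool" where
  "C1_path \<sigma> \<longleftrightarrow> \<sigma> C1_differentiable_on {0..1} \<and> \<sigma> ` {0..1} \<subseteq> \<Theta>"

lemma C1_curves_iff: "\<sigma> \<in> C1_curves \<Theta> x y \<longleftrightarrow> C1_path \<sigma> \<and> \<sigma> 0 = x \<and> \<sigma> 1 = y"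
  by (auto simp: C1_curves_def C1_path_def)

lemma nonneg: "x \<in> \<Theta> \<Longrightarrow> 0 \<le> v \<bullet> (G x *v v)"
  using positive[of x v] by (cases "v = 0") auto

lemma continuous_on_G_form:
  assumes "continuous_on S f" "continuous_on S v" "f ` S \<subseteq> \<Theta>"
  shows "continuous_on S (\<lambda>x. v x \<bullet> (G (f x) *v v x))"
proof -
  have "continuous_on S (\<lambda>x. G (f x))"
    using continuous_on_compose2[OF continuous_metric assms(1,3)] .
  then have "continuous_on S (\<lambda>x. G (f x) *v v x)"
    unfolding matrix_vector_mult_def
    by (intro continuous_on_vec_lambda continuous_intros assms)
  with assms show ?thesis by (intro continuous_intros)
qed

text \<open>By homogeneity it suffices to bound the form on the compact product of
  \<open>\<Theta>\<close> with the unit sphere, where it attains a positive minimum.\<close>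

lemma coercive:
  obtains c where "c > 0" "\<forall>x\<in>\<Theta>. \<forall>v. c * (norm v)\<^sup>2 \<le> v \<bullet> (G x *v v)"
proof (cases "\<Theta> = {}")
  case True
  then show ?thesis by (auto intro: that[of 1])
next
  case False
  let ?K = "\<Theta> \<times> sphere (0 :: real ^ 'd) 1"
  let ?f = "\<lambda>z. snd z \<bullet> (G (fst z) *v snd z)"
  have "compact ?K" by (intro compact_Times compact compact_sphere)
  moreover have "?K \<noteq> {}" using False by simp
  moreover have "continuous_on ?K ?f"
    by (intro continuous_on_G_form continuous_intros) auto
  ultimately obtain z where z: "z \<in> ?K" "\<And>y. y \<in> ?K \<Longrightarrow> ?f z \<le> ?f y"
    using continuous_attains_inf[of ?K ?f] by blast
  show ?thesis
  proof (rule that[of "?f z"])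
    show "?f z > 0"
      using z(1) by (intro positive) auto
    have "?f z * (norm v)\<^sup>2 \<le> v \<bullet> (G x *v v)" if x: "x \<in> \<Theta>" for x v
    proof (cases "v = 0")
      case False
      let ?u = "(1 / norm v) *\<^sub>R v"
      have "(x, ?u) \<in> ?K" using x False by simp
      from z(2)[OF this] have "?f z \<le> (v \<bullet> (G x *v v)) / (norm v)\<^sup>2"
        by (simp add: matrix_vector_mult_scaleR power2_eq_square)
      then show ?thesis using False by (simp add: field_simps)
    qed simp
    then show "\<forall>x\<in>\<Theta>. \<forall>v. ?f z * (norm v)\<^sup>2 \<le> v \<bullet> (G x *v v)" by blast
  qed
qed

section \<open>Energy of C^1 curves\<close>

lemma vel_works:
  assumes "C1_path \<sigma>" "t \<in> {0..1}"
  shows "(\<sigma> has_vector_derivative vel \<sigma> t) (at t)"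
  using assms by (simp add: C1_path_def C1_differentiable_on_eq vector_derivative_works[symmetric])

lemma continuous_on_vel: "C1_path \<sigma> \<Longrightarrow> continuous_on {0..1} (vel \<sigma>)"
  by (simp add: C1_path_def C1_differentiable_on_eq)

lemma continuous_on_C1_path:
  assumes "C1_path \<sigma>"
  shows "continuous_on {0..1} \<sigma>"
  using vel_works[OF assms] has_vector_derivative_continuous
  by (intro continuous_at_imp_continuous_on) blast

lemma C1_path_in: "C1_path \<sigma> \<Longrightarrow> t \<in> {0..1} \<Longrightarrow> \<sigma> t \<in> \<Theta>"
  by (auto simp: C1_path_def)

lemma continuous_on_density: "C1_path \<sigma> \<Longrightarrow> continuous_on {0..1} (density \<sigma>)"
  by (intro continuous_on_G_form continuous_on_C1_path continuous_on_vel) (auto simp: C1_path_in)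

lemma density_nonneg: "C1_path \<sigma> \<Longrightarrow> t \<in> {0..1} \<Longrightarrow> 0 \<le> density \<sigma> t"
  by (intro nonneg C1_path_in)

lemma density_integrable:
  assumes "C1_path \<sigma>" "0 \<le> s" "t \<le> 1"
  shows "density \<sigma> integrable_on {s..t}"
  using assms
  by (intro integrable_continuous_real continuous_on_subset[OF continuous_on_density]) auto

lemma energy_nonneg: "C1_path \<sigma> \<Longrightarrow> 0 \<le> energy \<sigma>"
  unfolding curve_energy_def by (intro integral_nonneg density_integrable density_nonneg) auto

lemma energy_split:
  assumes "C1_path \<sigma>" "0 \<le> s" "s \<le> t" "t \<le> 1"
  shows "energy \<sigma> = integral {0..s} (density \<sigma>) + integral {s..t} (density \<sigma>)
    + integral {t..1} (density \<sigma>)"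
proof -
  have "integral {0..s} (density \<sigma>) + integral {s..1} (density \<sigma>) = energy \<sigma>"
    unfolding curve_energy_def using assms
    by (intro Henstock_Kurzweil_Integration.integral_combine density_integrable) auto
  moreover have "integral {s..t} (density \<sigma>) + integral {t..1} (density \<sigma>) = integral {s..1} (density \<sigma>)"
    using assms
    by (intro Henstock_Kurzweil_Integration.integral_combine density_integrable) auto
  ultimately show ?thesis by simp
qed

lemma partial_energy_le:
  assumes "C1_path \<sigma>" "0 \<le> s" "s \<le> t" "t \<le> 1"
  shows "integral {s..t} (density \<sigma>) \<le> energy \<sigma>"
  unfolding curve_energy_def
proof (rule integral_subset_le)
  show "\<forall>x\<in>{0..1}. 0 \<le> density \<sigma> x" using density_nonneg[OF assms(1)] by blast
qed (use assms in \<open>auto intro!: density_integrable\<close>)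

text \<open>Young's inequality for \<open>\<Delta> \<bullet> \<sigma>'\<close> with \<open>\<Delta>\<close> the displacement replaces Cauchy-Schwarz for
  integrals.\<close>

lemma displacement_le_energy:
  assumes c: "c > 0" "\<forall>x\<in>\<Theta>. \<forall>v. c * (norm v)\<^sup>2 \<le> v \<bullet> (G x *v v)"
    and \<sigma>: "C1_path \<sigma>" and st: "0 \<le> s" "s \<le> t" "t \<le> 1"
  shows "c * (norm (\<sigma> t - \<sigma> s))\<^sup>2 \<le> (t - s) * integral {s..t} (density \<sigma>)"
proof (cases "s = t")
  case False
  define h where "h = t - s"
  have h: "h > 0" using st False by (simp add: h_def)
  define \<Delta> where "\<Delta> = \<sigma> t - \<sigma> s"
  \<comment> \<open>The weights \<open>1 / (2 * h)\<close> and \<open>h / 2\<close> are chosen so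
    that the first term integrates to half of the left-hand side and is absorbed.\<close>
  let ?g = "\<lambda>\<tau>. c * (norm \<Delta>)\<^sup>2 / (2 * h) + h / 2 * density \<sigma> \<tau>"
  have int: "density \<sigma> integrable_on {s..t}"
    using st by (intro density_integrable \<sigma>)
  have "c * (\<Delta> \<bullet> \<sigma> t) - c * (\<Delta> \<bullet> \<sigma> s) \<le> integral {s..t} ?g"
  proof (rule derivative_le_imp_diff_le_integral[OF \<open>s \<le> t\<close>])
    fix \<tau> assume \<tau>: "\<tau> \<in> {s..t}"
    then have \<tau>': "\<tau> \<in> {0..1}" using st by auto
    have "(\<sigma> has_derivative (\<lambda>x. x *\<^sub>R vel \<sigma> \<tau>)) (at \<tau> within {s..t})"
      using vel_works[OF \<sigma> \<tau>'] by (simp add: has_vector_derivative_def has_derivative_at_withinI)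
    then have "((\<lambda>\<tau>. c * (\<Delta> \<bullet> \<sigma> \<tau>)) has_derivative (\<lambda>x. c * (\<Delta> \<bullet> (x *\<^sub>R vel \<sigma> \<tau>)))) (at \<tau> within {s..t})"
      by (intro has_derivative_mult_right has_derivative_inner_right)
    then show "((\<lambda>\<tau>. c * (\<Delta> \<bullet> \<sigma> \<tau>)) has_real_derivative c * (\<Delta> \<bullet> vel \<sigma> \<tau>)) (at \<tau> within {s..t})"
      unfolding has_field_derivative_def
      by (rule has_derivative_eq_rhs) (simp add: fun_eq_iff)
    have "0 \<le> (norm (\<Delta> - h *\<^sub>R vel \<sigma> \<tau>))\<^sup>2" by simp
    also have "\<dots> = (norm \<Delta>)\<^sup>2 - 2 * h * (\<Delta> \<bullet> vel \<sigma> \<tau>) + h\<^sup>2 * (norm (vel \<sigma> \<tau>))\<^sup>2"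
      unfolding power2_norm_eq_inner
      by (simp add: inner_diff_left inner_diff_right inner_commute power2_eq_square algebra_simps)
    finally have "\<Delta> \<bullet> vel \<sigma> \<tau> \<le> (norm \<Delta>)\<^sup>2 / (2 * h) + h / 2 * (norm (vel \<sigma> \<tau>))\<^sup>2"
      using h by (simp add: field_simps power2_eq_square)
    then have "c * (\<Delta> \<bullet> vel \<sigma> \<tau>) \<le> c * ((norm \<Delta>)\<^sup>2 / (2 * h) + h / 2 * (norm (vel \<sigma> \<tau>))\<^sup>2)"
      using c(1) by (intro mult_left_mono) auto
    also have "\<dots> = c * (norm \<Delta>)\<^sup>2 / (2 * h) + h / 2 * (c * (norm (vel \<sigma> \<tau>))\<^sup>2)"
      by (simp add: algebra_simps)
    also have "\<dots> \<le> ?g \<tau>"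
      using h bspec[OF c(2) C1_path_in[OF \<sigma> \<tau>']] by simp
    finally show "c * (\<Delta> \<bullet> vel \<sigma> \<tau>) \<le> ?g \<tau>" .
  qed (intro integrable_add integrable_on_mult_right int integrable_const_ivl)
  also have "integral {s..t} ?g = h * (c * (norm \<Delta>)\<^sup>2 / (2 * h)) + h / 2 * integral {s..t} (density \<sigma>)"
    using st int by (subst Henstock_Kurzweil_Integration.integral_add)
      (auto simp: h_def intro: integrable_on_mult_right)
  also have "h * (c * (norm \<Delta>)\<^sup>2 / (2 * h)) = c * (norm \<Delta>)\<^sup>2 / 2"
    using h by simp
  also have "c * (\<Delta> \<bullet> \<sigma> t) - c * (\<Delta> \<bullet> \<sigma> s) = c * (norm \<Delta>)\<^sup>2"
    unfolding power2_norm_eq_inner by (simp add: \<Delta>_def inner_diff_right algebra_simps)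
  finally show ?thesis by (simp add: \<Delta>_def h_def)
qed simp

lemma reparametrize:
  assumes \<sigma>: "C1_path \<sigma>"
    and \<phi>: "\<And>t. t \<in> {0..1} \<Longrightarrow> (\<phi> has_real_derivative \<psi> t) (at t)"
    and \<psi>: "continuous_on {0..1} \<psi>"
    and range: "\<phi> ` {0..1} \<subseteq> {0..1}"
  shows "C1_path (\<lambda>t. \<sigma> (\<phi> t))"
    and "t \<in> {0..1} \<Longrightarrow> vel (\<lambda>t. \<sigma> (\<phi> t)) t = \<psi> t *\<^sub>R vel \<sigma> (\<phi> t)"
proof -
  have d: "((\<lambda>t. \<sigma> (\<phi> t)) has_vector_derivative \<psi> t *\<^sub>R vel \<sigma> (\<phi> t)) (at t)" if "t \<in> {0..1}" for t
  proof -
    have "(\<phi> has_vector_derivative \<psi> t) (at t)"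
      using \<phi>[OF that] by (simp add: has_real_derivative_iff_has_vector_derivative)
    moreover have "(\<sigma> has_vector_derivative vel \<sigma> (\<phi> t)) (at (\<phi> t))"
      using that range by (intro vel_works \<sigma>) blast
    ultimately show ?thesis
      using vector_diff_chain_at[of \<phi> "\<psi> t" t \<sigma>] by (simp add: o_def)
  qed
  then show "t \<in> {0..1} \<Longrightarrow> vel (\<lambda>t. \<sigma> (\<phi> t)) t = \<psi> t *\<^sub>R vel \<sigma> (\<phi> t)"
    by (intro vector_derivative_at)
  have "continuous_on {0..1} \<phi>"
    using \<phi> DERIV_isCont by (intro continuous_at_imp_continuous_on) blast
  then have "continuous_on {0..1} (\<lambda>t. vel \<sigma> (\<phi> t))"
    using continuous_on_compose2[OF continuous_on_vel[OF \<sigma>]] range by blast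
  then have "continuous_on {0..1} (\<lambda>t. \<psi> t *\<^sub>R vel \<sigma> (\<phi> t))"
    by (intro continuous_intros \<psi>)
  with d have "(\<lambda>t. \<sigma> (\<phi> t)) C1_differentiable_on {0..1}"
    unfolding C1_differentiable_on_def by (intro exI[of _ "\<lambda>t. \<psi> t *\<^sub>R vel \<sigma> (\<phi> t)"]) simp
  moreover have "\<sigma> (\<phi> t) \<in> \<Theta>" if "t \<in> {0..1}" for t
    using C1_path_in[OF \<sigma>] range that by blast
  ultimately show "C1_path (\<lambda>t. \<sigma> (\<phi> t))"
    by (simp only: C1_path_def image_subset_iff) blast
qed

section \<open>The metric axioms for the distance\<close>

lemma dist_nonneg: "x \<in> \<Theta> \<Longrightarrow> y \<in> \<Theta> \<Longrightarrow> 0 \<le> d\<^sub>G x y"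
  unfolding curve_dist_def using curves
  by (intro real_sqrt_ge_zero cINF_greatest) (auto simp: C1_curves_iff energy_nonneg)

lemma dist_power2:
  assumes "x \<in> \<Theta>" "y \<in> \<Theta>"
  shows "(d\<^sub>G x y)\<^sup>2 = (INF \<sigma>\<in>C1_curves \<Theta> x y. energy \<sigma>)"
  unfolding curve_dist_def using curves[OF assms]
  by (intro real_sqrt_pow2 cINF_greatest) (auto simp: C1_curves_iff energy_nonneg)

lemma dist_le_energy:
  assumes "\<sigma> \<in> C1_curves \<Theta> x y"
  shows "(d\<^sub>G x y)\<^sup>2 \<le> energy \<sigma>"
proof -
  have "x \<in> \<Theta>" "y \<in> \<Theta>"
    using assms C1_path_in[of \<sigma> 0] C1_path_in[of \<sigma> 1] by (auto simp: C1_curves_iff)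
  then show ?thesis
    using assms by (subst dist_power2) (auto intro!: cINF_lower bdd_belowI2[where m = 0] simp: C1_curves_iff energy_nonneg)
qed

lemma near_optimal_curve:
  assumes "x \<in> \<Theta>" "y \<in> \<Theta>" "e > 0"
  obtains \<sigma> where "\<sigma> \<in> C1_curves \<Theta> x y" "energy \<sigma> < (d\<^sub>G x y)\<^sup>2 + e"
proof -
  have "(INF \<sigma>\<in>C1_curves \<Theta> x y. energy \<sigma>) < (d\<^sub>G x y)\<^sup>2 + e"
    using assms by (simp add: dist_power2)
  moreover have "bdd_below (energy ` C1_curves \<Theta> x y)"
    by (intro bdd_belowI2[where m = 0]) (simp add: C1_curves_iff energy_nonneg)
  ultimately show ?thesis
    using that curves[OF assms(1,2)] cINF_less_iff by metis
qed

lemma dist_self: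
  assumes "x \<in> \<Theta>"
  shows "d\<^sub>G x x = 0"
proof -
  have "(\<lambda>t. x) \<in> C1_curves \<Theta> x x"
    using assms by (auto simp: C1_curves_def)
  then have "(d\<^sub>G x x)\<^sup>2 \<le> energy (\<lambda>t. x)" by (rule dist_le_energy)
  also have "energy (\<lambda>t. x) = 0" by (simp add: curve_energy_def)
  finally show ?thesis by simp
qed

lemma norm_le_dist:
  assumes c: "c > 0" "\<forall>x\<in>\<Theta>. \<forall>v. c * (norm v)\<^sup>2 \<le> v \<bullet> (G x *v v)"
    and "x \<in> \<Theta>" "y \<in> \<Theta>"
  shows "c * (norm (x - y))\<^sup>2 \<le> (d\<^sub>G x y)\<^sup>2"
  unfolding dist_power2[OF assms(3,4)]
proof (rule cINF_greatest)
  show "C1_curves \<Theta> x y \<noteq> {}" using assms by (intro curves)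
  fix \<sigma> assume "\<sigma> \<in> C1_curves \<Theta> x y"
  then show "c * (norm (x - y))\<^sup>2 \<le> energy \<sigma>"
    using displacement_le_energy[OF c, of \<sigma> 0 1]
    by (simp add: C1_curves_iff curve_energy_def norm_minus_commute)
qed

text \<open>Rescaling the arc over \<open>[s, t]\<close> to the unit interval multiplies the density
  by \<open>(t - s)\<^sup>2\<close>; one factor is used up by the substitution, the other
  remains.\<close>

lemma dist_le_sub_energy:
  assumes \<sigma>: "C1_path \<sigma>" and st: "0 \<le> s" "s \<le> t" "t \<le> 1"
  shows "(d\<^sub>G (\<sigma> s) (\<sigma> t))\<^sup>2 \<le> (t - s) * integral {s..t} (density \<sigma>)"
proof -
  let ?\<phi> = "\<lambda>\<tau>. s + (t - s) * \<tau>"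
  let ?\<tau> = "\<lambda>\<tau>. \<sigma> (?\<phi> \<tau>)"
  have d: "(?\<phi> has_real_derivative t - s) (at \<tau> within S)" for \<tau> S
    by (auto intro!: derivative_eq_intros)
  have range: "?\<phi> ` {0..1} \<subseteq> {s..t}"
  proof safe
    fix \<tau> :: real assume "\<tau> \<in> {0..1}"
    then have "0 \<le> (t - s) * \<tau>" "(t - s) * \<tau> \<le> (t - s) * 1"
      using st mult_left_mono[of \<tau> 1 "t - s"] by auto
    then show "?\<phi> \<tau> \<in> {s..t}" by auto
  qed
  also have "{s..t} \<subseteq> {0..1}" using st by auto
  finally have range': "?\<phi> ` {0..1} \<subseteq> {0..1}" .
  note r = reparametrize[OF \<sigma> d continuous_on_const range']
  have "?\<tau> \<in> C1_curves \<Theta> (\<sigma> s) (\<sigma> t)"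
    using r(1) by (simp add: C1_curves_iff)
  then have "(d\<^sub>G (\<sigma> s) (\<sigma> t))\<^sup>2 \<le> energy ?\<tau>" by (rule dist_le_energy)
  also have "energy ?\<tau> = integral {0..1} (\<lambda>\<tau>. (t - s) * ((t - s) *\<^sub>R density \<sigma> (?\<phi> \<tau>)))"
    unfolding curve_energy_def
    by (rule integral_cong) (simp add: r(2) matrix_vector_mult_scaleR)
  also have "((\<lambda>\<tau>. (t - s) *\<^sub>R density \<sigma> (?\<phi> \<tau>)) has_integral integral {?\<phi> 0..?\<phi> 1} (density \<sigma>)) {0..1}"
    using st range by (intro has_integral_substitution[where c = s and d = t] d
        continuous_on_subset[OF continuous_on_density[OF \<sigma>]]) auto
  then have "integral {0..1} (\<lambda>\<tau>. (t - s) * ((t - s) *\<^sub>R density \<sigma> (?\<phi> \<tau>)))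
      = (t - s) * integral {s..t} (density \<sigma>)"
    by (intro integral_unique has_integral_mult_right) simp
  finally show ?thesis .
qed

text \<open>Reversing a curve preserves its energy.\<close>

lemma dist_sym_le:
  assumes "x \<in> \<Theta>" "y \<in> \<Theta>"
  shows "(d\<^sub>G y x)\<^sup>2 \<le> (d\<^sub>G x y)\<^sup>2"
  unfolding dist_power2[OF assms]
proof (rule cINF_greatest)
  show "C1_curves \<Theta> x y \<noteq> {}" using assms by (intro curves)
  fix \<sigma> assume c: "\<sigma> \<in> C1_curves \<Theta> x y"
  then have \<sigma>: "C1_path \<sigma>" by (simp add: C1_curves_iff)
  have d: "((\<lambda>\<tau>. 1 - \<tau>) has_real_derivative - 1) (at \<tau> within S)" for \<tau> :: real and S
    by (auto intro!: derivative_eq_intros)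
  have "(\<lambda>\<tau>::real. 1 - \<tau>) ` {0..1} \<subseteq> {0..1}" by auto
  note r = reparametrize[OF \<sigma> d continuous_on_const this]
  have "(\<lambda>\<tau>. \<sigma> (1 - \<tau>)) \<in> C1_curves \<Theta> y x"
    using r(1) c by (auto simp: C1_curves_iff)
  then have "(d\<^sub>G y x)\<^sup>2 \<le> energy (\<lambda>\<tau>. \<sigma> (1 - \<tau>))" by (rule dist_le_energy)
  also have "energy (\<lambda>\<tau>. \<sigma> (1 - \<tau>)) = integral {0..1} (\<lambda>\<tau>. density \<sigma> (1 - \<tau>))"
    unfolding curve_energy_def
    by (rule integral_cong) (simp add: r(2) matrix_vector_mult_scaleR[of _ "- 1", simplified])
  also have "\<dots> = energy \<sigma>"
  proof -
    \<comment> \<open>The substitution rule gives a difference of integrals over both orientations;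
      the interval from 1 to 0 is empty, so only the subtracted term survives.\<close>
    have "((\<lambda>\<tau>. (- 1) *\<^sub>R density \<sigma> (1 - \<tau>)) has_integral
        (integral {1 - 0..1 - 1} (density \<sigma>) - integral {1 - 1..1 - 0} (density \<sigma>))) {0..1::real}"
      by (intro has_integral_substitution_general[where s = "{}" and c = 0 and d = 1 and g = "\<lambda>\<tau>. 1 - \<tau>"]
          d continuous_on_density \<sigma> continuous_intros) auto
    from has_integral_neg[OF this] show ?thesis
      by (simp add: curve_energy_def integral_unique)
  qed
  finally show "(d\<^sub>G y x)\<^sup>2 \<le> energy \<sigma>" .
qed

lemma dist_sym: "x \<in> \<Theta> \<Longrightarrow> y \<in> \<Theta> \<Longrightarrow> d\<^sub>G x y = d\<^sub>G y x"
  using dist_sym_le[of x y] dist_sym_le[of y x] dist_nonneg[of x y] dist_nonneg[of y x]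
  by (simp add: power2_eq_iff_nonneg)

text \<open>Of the two factors \<psi> in the new density, one is bounded by \<open>C\<close> and the
  other is the Jacobian of the substitution.\<close>

lemma reparametrized_energy_le:
  assumes \<sigma>: "C1_path \<sigma>" and "a \<le> b"
    and \<phi>: "\<And>t. t \<in> {a..b} \<Longrightarrow> (\<phi> has_real_derivative \<psi> t) (at t)"
    and \<psi>: "\<And>t. t \<in> {a..b} \<Longrightarrow> 0 \<le> \<psi> t \<and> \<psi> t \<le> C"
    and range: "\<phi> ` {a..b} \<subseteq> {0..1}" "\<phi> a = 0" "\<phi> b = 1"
    and f: "f integrable_on {a..b}" "\<And>t. t \<in> {a..b} \<Longrightarrow> f t = (\<psi> t)\<^sup>2 * density \<sigma> (\<phi> t)"
  shows "integral {a..b} f \<le> C * energy \<sigma>"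
proof -
  have "((\<lambda>t. \<psi> t *\<^sub>R density \<sigma> (\<phi> t)) has_integral integral {\<phi> a..\<phi> b} (density \<sigma>)) {a..b}"
    using range
    by (intro has_integral_substitution[where c = 0 and d = 1] continuous_on_density \<sigma> \<open>a \<le> b\<close>
        has_field_derivative_at_within[OF \<phi>]) auto
  then have "((\<lambda>t. C * (\<psi> t *\<^sub>R density \<sigma> (\<phi> t))) has_integral C * energy \<sigma>) {a..b}"
    using range by (intro has_integral_mult_right) (simp add: curve_energy_def)
  then show ?thesis
  proof (rule has_integral_le[OF integrable_integral[OF f(1)]])
    fix t assume t: "t \<in> {a..b}"
    then have "\<phi> t \<in> {0..1}" using range by blast
    then have "0 \<le> density \<sigma> (\<phi> t)" by (rule density_nonneg[OF \<sigma>])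
    then have "\<psi> t * (\<psi> t * density \<sigma> (\<phi> t)) \<le> C * (\<psi> t * density \<sigma> (\<phi> t))"
      using \<psi>[OF t] by (intro mult_right_mono mult_nonneg_nonneg) auto
    then show "f t \<le> C * (\<psi> t *\<^sub>R density \<sigma> (\<phi> t))"
      by (simp add: f(2)[OF t] power2_eq_square mult.assoc)
  qed
qed

text \<open>Both curves are run with velocity zero at the junction, so that their concatenation is again
  \<open>C\<^sup>1\<close>; a trapezoidal velocity profile makes the cost of stopping arbitrarily small.\<close>

lemma concatenate:
  assumes \<sigma>1: "\<sigma>1 \<in> C1_curves \<Theta> x y" and \<sigma>2: "\<sigma>2 \<in> C1_curves \<Theta> y z"
    and c: "c > 1" and l: "0 < l" "l < 1"
  obtains \<tau> where "\<tau> \<in> C1_curves \<Theta> x z" "energy \<tau> \<le> c * (energy \<sigma>1 / l + energy \<sigma>2 / (1 - l))"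
proof -
  obtain \<phi> \<psi> :: "real \<Rightarrow> real"
    where \<phi>: "\<And>t. (\<phi> has_real_derivative \<psi> t) (at t)" and \<psi>: "continuous_on UNIV \<psi>"
      and nonneg: "\<And>t. 0 \<le> \<psi> t" and le: "\<And>t. \<psi> t \<le> c"
      and \<phi>0: "\<And>t. t \<le> 0 \<Longrightarrow> \<phi> t = 0" and \<phi>1: "\<And>t. t \<ge> 1 \<Longrightarrow> \<phi> t = 1"
      and \<psi>0: "\<And>t. t \<le> 0 \<or> t \<ge> 1 \<Longrightarrow> \<psi> t = 0" and range: "\<And>t. 0 \<le> \<phi> t \<and> \<phi> t \<le> 1"
    using smooth_step[OF c] by blast
  have p1: "C1_path \<sigma>1" and p2: "C1_path \<sigma>2" and ends: "\<sigma>1 0 = x" "\<sigma>1 1 = y" "\<sigma>2 0 = y" "\<sigma>2 1 = z"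
    using \<sigma>1 \<sigma>2 by (simp_all add: C1_curves_iff)
  define m where "m = 1 - l"
  have m: "m > 0" "l + m = 1" using l by (auto simp: m_def)
  define \<phi>1' where "\<phi>1' = (\<lambda>t. \<phi> (t / l))"
  define \<phi>2' where "\<phi>2' = (\<lambda>t. \<phi> ((t - l) / m))"
  define \<psi>1' where "\<psi>1' = (\<lambda>t. \<psi> (t / l) / l)"
  define \<psi>2' where "\<psi>2' = (\<lambda>t. \<psi> ((t - l) / m) / m)"
  have D1: "(\<phi>1' has_real_derivative \<psi>1' t) (at t)" for t
    unfolding \<phi>1'_def \<psi>1'_def
    using DERIV_chain2[OF \<phi> DERIV_cdivide[OF DERIV_ident]] by simp
  have D2: "(\<phi>2' has_real_derivative \<psi>2' t) (at t)" for t
    unfolding \<phi>2'_def \<psi>2'_def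
    using DERIV_chain2[OF \<phi> DERIV_cdivide[OF DERIV_diff[OF DERIV_ident DERIV_const]]] by simp
  have C1: "continuous_on {0..1} \<psi>1'" and C2: "continuous_on {0..1} \<psi>2'"
    unfolding \<psi>1'_def \<psi>2'_def using l m
    by (auto intro!: continuous_intros continuous_on_compose2[OF \<psi>])
  have r1: "\<phi>1' ` A \<subseteq> {0..1}" and r2: "\<phi>2' ` A \<subseteq> {0..1}" for A
    using range by (auto simp: \<phi>1'_def \<phi>2'_def)
  note q1 = reparametrize[OF p1 D1 C1 r1] and q2 = reparametrize[OF p2 D2 C2 r2]
  \<comment> \<open>A sum in place of a case distinction: before time \<open>l\<close> the second
    curve rests at \<open>y\<close>, after it the first one does. So \<tau> is differentiable
    without gluing derivatives at \<open>l\<close>.\<close>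
  define \<tau> where "\<tau> = (\<lambda>t. \<sigma>1 (\<phi>1' t) + \<sigma>2 (\<phi>2' t) - y)"
  define v where "v = (\<lambda>t. \<psi>1' t *\<^sub>R vel \<sigma>1 (\<phi>1' t) + \<psi>2' t *\<^sub>R vel \<sigma>2 (\<phi>2' t))"
  have d: "(\<tau> has_vector_derivative v t) (at t)" if "t \<in> {0..1}" for t
    using has_vector_derivative_diff_const vel_works[OF q1(1) that] vel_works[OF q2(1) that]
    unfolding \<tau>_def v_def q1(2)[OF that, symmetric] q2(2)[OF that, symmetric]
    by (auto intro!: derivative_eq_intros)
  have first: "\<tau> t = \<sigma>1 (\<phi>1' t)" "v t = \<psi>1' t *\<^sub>R vel \<sigma>1 (\<phi>1' t)" if "t \<le> l" for t
    using that m ends by (auto simp: \<tau>_def v_def \<phi>2'_def \<psi>2'_def \<phi>0 \<psi>0 divide_le_0_iff)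
  have second: "\<tau> t = \<sigma>2 (\<phi>2' t)" "v t = \<psi>2' t *\<^sub>R vel \<sigma>2 (\<phi>2' t)" if "t \<ge> l" for t
    using that l ends by (auto simp: \<tau>_def v_def \<phi>1'_def \<psi>1'_def \<phi>1 \<psi>0 le_divide_eq)
  have "continuous_on {0..1} v"
  proof -
    have "continuous_on {0..1} (\<lambda>t. vel (\<lambda>t. \<sigma>1 (\<phi>1' t)) t + vel (\<lambda>t. \<sigma>2 (\<phi>2' t)) t)"
      by (intro continuous_on_add continuous_on_vel q1(1) q2(1))
    then show ?thesis
      by (rule continuous_on_eq) (simp add: v_def q1(2) q2(2))
  qed
  with d have "\<tau> C1_differentiable_on {0..1}"
    unfolding C1_differentiable_on_def by (intro exI[of _ v]) simp
  moreover have "\<tau> t \<in> \<Theta>" if "t \<in> {0..1}" for t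
    using first(1)[of t] second(1)[of t] C1_path_in[OF p1, of "\<phi>1' t"] C1_path_in[OF p2, of "\<phi>2' t"]
      r1[of UNIV] r2[of UNIV] by (cases "t \<le> l") (auto simp: image_subset_iff)
  ultimately have \<tau>: "C1_path \<tau>" by (auto simp: C1_path_def)
  have e1: "\<phi>1' 0 = 0" "\<phi>1' l = 1" and e2: "\<phi>2' l = 0" "\<phi>2' 1 = 1"
    using l m by (auto simp: \<phi>1'_def \<phi>2'_def \<phi>0 \<phi>1 m_def)
  have "\<tau> 0 = x" "\<tau> 1 = z"
    using first(1)[of 0] second(1)[of 1] l e1 e2 ends by auto
  with \<tau> have curve: "\<tau> \<in> C1_curves \<Theta> x z" by (simp add: C1_curves_iff)
  have vel: "vel \<tau> t = v t" if "t \<in> {0..1}" for t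
    using d[OF that] by (rule vector_derivative_at)
  have "integral {0..l} (density \<tau>) \<le> (c / l) * energy \<sigma>1"
  proof (rule reparametrized_energy_le[OF p1 _ D1 _ r1 e1])
    show "density \<tau> integrable_on {0..l}" using l by (intro density_integrable \<tau>) auto
    show "0 \<le> \<psi>1' t \<and> \<psi>1' t \<le> c / l" for t
      using l nonneg le by (auto simp: \<psi>1'_def intro!: divide_right_mono)
    show "density \<tau> t = (\<psi>1' t)\<^sup>2 * density \<sigma>1 (\<phi>1' t)" if "t \<in> {0..l}" for t
      using that l by (simp add: vel first matrix_vector_mult_scaleR power2_eq_square)
  qed (use l in auto)
  moreover have "integral {l..1} (density \<tau>) \<le> (c / m) * energy \<sigma>2"
  proof (rule reparametrized_energy_le[OF p2 _ D2 _ r2 e2])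
    show "density \<tau> integrable_on {l..1}" using l by (intro density_integrable \<tau>) auto
    show "0 \<le> \<psi>2' t \<and> \<psi>2' t \<le> c / m" for t
      using m nonneg le by (auto simp: \<psi>2'_def intro!: divide_right_mono)
    show "density \<tau> t = (\<psi>2' t)\<^sup>2 * density \<sigma>2 (\<phi>2' t)" if "t \<in> {l..1}" for t
      using that l by (simp add: vel second matrix_vector_mult_scaleR power2_eq_square)
  qed (use l in auto)
  moreover have "energy \<tau> = integral {0..l} (density \<tau>) + integral {l..1} (density \<tau>)"
    using energy_split[OF \<tau>, of 0 l] l by simp
  ultimately have "energy \<tau> \<le> c * (energy \<sigma>1 / l + energy \<sigma>2 / (1 - l))"
    by (simp add: m_def algebra_simps)
  with curve show ?thesis by (rule that)
qed

text \<open>The strict bounds leave room for near-optimal curves; the factor \<open>c\<close>, the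
  cost of stopping at the junction, is removed by letting it tend to 1.\<close>

lemma dist_triangle_power2:
  assumes xyz: "x \<in> \<Theta>" "y \<in> \<Theta>" "z \<in> \<Theta>" and l: "0 < l" "l < 1"
    and a: "d\<^sub>G x y < a" and b: "d\<^sub>G y z < b"
  shows "(d\<^sub>G x z)\<^sup>2 \<le> a\<^sup>2 / l + b\<^sup>2 / (1 - l)"
proof -
  have "(d\<^sub>G x y)\<^sup>2 < a\<^sup>2" "(d\<^sub>G y z)\<^sup>2 < b\<^sup>2"
    using a b xyz by (auto intro!: power_strict_mono dist_nonneg)
  then have pos: "a\<^sup>2 - (d\<^sub>G x y)\<^sup>2 > 0" "b\<^sup>2 - (d\<^sub>G y z)\<^sup>2 > 0" by simp_all
  obtain \<sigma>1 where c1: "\<sigma>1 \<in> C1_curves \<Theta> x y" "energy \<sigma>1 < a\<^sup>2"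
    using near_optimal_curve[OF xyz(1,2) pos(1)] by (metis add.commute diff_add_cancel)
  obtain \<sigma>2 where c2: "\<sigma>2 \<in> C1_curves \<Theta> y z" "energy \<sigma>2 < b\<^sup>2"
    using near_optimal_curve[OF xyz(2,3) pos(2)] by (metis add.commute diff_add_cancel)
  have le: "(d\<^sub>G x z)\<^sup>2 \<le> c * (energy \<sigma>1 / l + energy \<sigma>2 / (1 - l))" if c: "c > 1" for c
  proof -
    obtain \<tau> where "\<tau> \<in> C1_curves \<Theta> x z"
      and "energy \<tau> \<le> c * (energy \<sigma>1 / l + energy \<sigma>2 / (1 - l))"
      by (rule concatenate[OF c1(1) c2(1) c l])
    then show ?thesis using dist_le_energy[of \<tau> x z] by linarith
  qed
  have "((\<lambda>c. c * (energy \<sigma>1 / l + energy \<sigma>2 / (1 - l))) \<longlongrightarrow>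
      1 * (energy \<sigma>1 / l + energy \<sigma>2 / (1 - l))) (at_right 1)"
    by (intro tendsto_intros)
  then have "(d\<^sub>G x z)\<^sup>2 \<le> 1 * (energy \<sigma>1 / l + energy \<sigma>2 / (1 - l))"
    by (rule tendsto_lowerbound) (auto simp: le intro!: eventually_at_rightI[of 1 2])
  also have "\<dots> \<le> a\<^sup>2 / l + b\<^sup>2 / (1 - l)"
    using c1 c2 l by (simp, intro add_mono divide_right_mono) auto
  finally show ?thesis .
qed

lemma dist_triangle:
  assumes xyz: "x \<in> \<Theta>" "y \<in> \<Theta>" "z \<in> \<Theta>"
  shows "d\<^sub>G x z \<le> d\<^sub>G x y + d\<^sub>G y z"
proof (rule field_le_epsilon)
  fix e :: real assume "e > 0"
  define a where "a = d\<^sub>G x y + e / 2"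
  define b where "b = d\<^sub>G y z + e / 2"
  have pos: "a > 0" "b > 0"
    using \<open>e > 0\<close> dist_nonneg xyz by (auto simp: a_def b_def intro!: add_nonneg_pos)
  \<comment> \<open>Time shares proportional to the lengths minimize
    \<open>a\<^sup>2 / l + b\<^sup>2 / (1 - l)\<close>, with value \<open>(a + b)\<^sup>2\<close>.
    The added \<open>e / 2\<close> keeps both shares positive when points coincide.\<close>
  define l where "l = a / (a + b)"
  have l: "0 < l" "l < 1" and l1: "1 - l = b / (a + b)"
    using pos by (auto simp: l_def field_simps)
  have "(d\<^sub>G x z)\<^sup>2 \<le> a\<^sup>2 / l + b\<^sup>2 / (1 - l)"
    using \<open>e > 0\<close> by (intro dist_triangle_power2[of x y z] xyz l) (auto simp: a_def b_def)
  also have "\<dots> = (a + b)\<^sup>2"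
  proof -
    have "a\<^sup>2 / l = a * (a + b)" "b\<^sup>2 / (1 - l) = b * (a + b)"
      unfolding l1 unfolding l_def using pos by (auto simp: power2_eq_square)
    then show ?thesis by (simp add: power2_eq_square algebra_simps)
  qed
  finally have "d\<^sub>G x z \<le> a + b"
    by (rule power2_le_imp_le) (use pos in linarith)
  then show "d\<^sub>G x z \<le> d\<^sub>G x y + d\<^sub>G y z + e"
    by (simp add: a_def b_def)
qed

lemma dist_eq_0_iff:
  assumes "x \<in> \<Theta>" "y \<in> \<Theta>"
  shows "d\<^sub>G x y = 0 \<longleftrightarrow> x = y"
proof
  obtain c where c: "c > 0" "\<forall>x\<in>\<Theta>. \<forall>v. c * (norm v)\<^sup>2 \<le> v \<bullet> (G x *v v)"
    by (rule coercive)
  assume "d\<^sub>G x y = 0"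
  with norm_le_dist[OF c assms] c(1) show "x = y"
    by (simp add: mult_le_0_iff)
qed (use assms dist_self in auto)

subsection \<open>Existence of geodesics\<close>

text \<open>Purely metric, like \<open>constant_speed_geodesic\<close>, so that a limit of curves
  can qualify without being differentiable.\<close>

definition geodesic :: "(real \<Rightarrow> real ^ 'd) \<Rightarrow> bool" where
  "geodesic \<gamma> \<longleftrightarrow> \<gamma> ` {0..1} \<subseteq> \<Theta> \<and>
     (\<forall>s\<in>{0..1}. \<forall>t\<in>{0..1}. d\<^sub>G (\<gamma> s) (\<gamma> t) = \<bar>s - t\<bar> * d\<^sub>G (\<gamma> 0) (\<gamma> 1))"

lemma geodesic_speed:
  "geodesic \<gamma> \<Longrightarrow> s \<in> {0..1} \<Longrightarrow> t \<in> {0..1} \<Longrightarrow>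
    d\<^sub>G (\<gamma> s) (\<gamma> t) = \<bar>s - t\<bar> * d\<^sub>G (\<gamma> 0) (\<gamma> 1)"
  unfolding geodesic_def by blast

lemma dist_sequence_tendsto:
  assumes "x \<in> \<Theta>" "y \<in> \<Theta>" "\<And>n. u n \<in> \<Theta>" "u \<longlonglongrightarrow> y"
  shows "(\<lambda>n. d\<^sub>G x (u n)) \<longlonglongrightarrow> d\<^sub>G x y"
  using continuous_on_tendsto_compose[OF continuous_dist[OF assms(1)] assms(4,2)] assms(3) by simp

text \<open>\<open>continuous_dist\<close> is continuity in one argument; the triangle inequality
  upgrades it to joint continuity.\<close>

lemma dist_sequences_tendsto:
  assumes "x \<in> \<Theta>" "y \<in> \<Theta>" "\<And>n. u n \<in> \<Theta>" "\<And>n. v n \<in> \<Theta>" "u \<longlonglongrightarrow> x" "v \<longlonglongrightarrow> y"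
  shows "(\<lambda>n. d\<^sub>G (u n) (v n)) \<longlonglongrightarrow> d\<^sub>G x y"
proof (subst Lim_null)
  have "(\<lambda>n. d\<^sub>G x (u n) + d\<^sub>G y (v n)) \<longlonglongrightarrow> d\<^sub>G x x + d\<^sub>G y y"
    using assms by (intro tendsto_add dist_sequence_tendsto)
  then have lim: "(\<lambda>n. d\<^sub>G x (u n) + d\<^sub>G y (v n)) \<longlonglongrightarrow> 0"
    using assms by (simp add: dist_self)
  have "norm (d\<^sub>G (u n) (v n) - d\<^sub>G x y) \<le> d\<^sub>G x (u n) + d\<^sub>G y (v n)" for n
    using dist_triangle[of x "u n" y] dist_triangle[of "u n" "v n" y] dist_triangle[of "u n" x "v n"]
      dist_triangle[of x y "v n"] dist_sym[of "u n" x] dist_sym[of "v n" y] assms(1-4)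
    by (simp add: abs_le_iff)
  then show "(\<lambda>n. d\<^sub>G (u n) (v n) - d\<^sub>G x y) \<longlonglongrightarrow> 0"
    by (intro Lim_null_comparison[OF _ lim] always_eventually) blast
qed

text \<open>Young's inequality in a form that includes \<open>s = 0\<close>, where the first
  assumption forces \<open>a = 0\<close>.\<close>

lemma young_of_power2_le:
  fixes a s D e :: real
  assumes "a\<^sup>2 \<le> s * e" "0 \<le> s" "0 \<le> e"
  shows "2 * D * a \<le> s * D\<^sup>2 + e"
proof (cases "s = 0")
  case False
  then have s: "s > 0" using assms by simp
  have "0 \<le> (s * D - a)\<^sup>2" by simp
  then have "s * (2 * D * a) \<le> s * (s * D\<^sup>2 + e)"
    using assms(1) by (simp add: power2_eq_square algebra_simps)
  then show ?thesis using s by simp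
qed (use assms in auto)

text \<open>A limit of curves whose energy approaches the squared distance has constant speed: the
  distances \<open>a\<^sub>i\<close> of consecutive points at parameter distance \<open>l\<^sub>i\<close> satisfy
  \<open>\<Sum>a\<^sub>i\<^sup>2 / l\<^sub>i \<le> D\<^sup>2\<close> in the limit, while \<open>\<Sum>a\<^sub>i \<ge> D\<close>.\<close>

lemma limit_constant_speed:
  assumes xy: "x \<in> \<Theta>" "y \<in> \<Theta>"
    and \<sigma>: "\<And>n. \<sigma> n \<in> C1_curves \<Theta> x y"
    and energy: "\<And>n. energy (\<sigma> n) \<le> (d\<^sub>G x y)\<^sup>2 + e n" and e: "e \<longlonglongrightarrow> 0"
    and lim: "\<And>t. t \<in> {0..1} \<Longrightarrow> (\<lambda>n. \<sigma> n t) \<longlonglongrightarrow> \<gamma> t"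
    and \<gamma>: "\<And>t. t \<in> {0..1} \<Longrightarrow> \<gamma> t \<in> \<Theta>"
    and st: "0 \<le> s" "s \<le> t" "t \<le> 1"
  shows "d\<^sub>G (\<gamma> s) (\<gamma> t) = (t - s) * d\<^sub>G x y"
proof -
  define D where "D = d\<^sub>G x y"
  define l where "l = t - s"
  define a1 where "a1 n = d\<^sub>G x (\<sigma> n s)" for n
  define a2 where "a2 n = d\<^sub>G (\<sigma> n s) (\<sigma> n t)" for n
  define a3 where "a3 n = d\<^sub>G (\<sigma> n t) y" for n
  have p: "C1_path (\<sigma> n)" "\<sigma> n 0 = x" "\<sigma> n 1 = y" for n
    using \<sigma>[of n] by (simp_all add: C1_curves_iff)
  have in\<Theta>: "\<sigma> n s \<in> \<Theta>" "\<sigma> n t \<in> \<Theta>" for n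
    using C1_path_in[OF p(1)] st by auto
  have g: "\<gamma> s \<in> \<Theta>" "\<gamma> t \<in> \<Theta>" using \<gamma> st by auto
  \<comment> \<open>Young's inequality is applied to the two outer arcs only; the middle one keeps
    its square, and multiplying by \<open>l\<close> instead of dividing covers
    \<open>l = 0\<close>.\<close>
  have bound: "l * (2 * D * (a1 n + a3 n)) + (a2 n)\<^sup>2 \<le> l * (2 - l) * D\<^sup>2 + l * e n" for n
  proof -
    let ?I = "\<lambda>u v. integral {u..v} (density (\<sigma> n))"
    have nn: "0 \<le> ?I u v" if "0 \<le> u" "v \<le> 1" for u v
      using that density_nonneg[OF p(1)[of n]] by (intro integral_nonneg density_integrable p) auto
    have "2 * D * a1 n \<le> s * D\<^sup>2 + ?I 0 s"
      using dist_le_sub_energy[OF p(1)[of n], of 0 s] st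
      by (intro young_of_power2_le nn) (simp_all add: a1_def p(2))
    moreover have "2 * D * a3 n \<le> (1 - t) * D\<^sup>2 + ?I t 1"
      using dist_le_sub_energy[OF p(1)[of n], of t 1] st
      by (intro young_of_power2_le nn) (simp_all add: a3_def p(3))
    moreover have "?I 0 s + ?I s t + ?I t 1 \<le> D\<^sup>2 + e n"
      using energy[of n] energy_split[OF p(1) st, of n] by (simp add: D_def)
    ultimately have "2 * D * (a1 n + a3 n) \<le> (2 - l) * D\<^sup>2 + e n - ?I s t"
      by (simp add: l_def algebra_simps)
    then have "l * (2 * D * (a1 n + a3 n)) \<le> l * ((2 - l) * D\<^sup>2 + e n - ?I s t)"
      using st by (intro mult_left_mono) (auto simp: l_def)
    moreover have "(a2 n)\<^sup>2 \<le> l * ?I s t"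
      using dist_le_sub_energy[OF p(1) st, of n] by (simp add: a2_def l_def)
    ultimately show ?thesis by (simp add: algebra_simps)
  qed
  have s01: "s \<in> {0..1}" and t01: "t \<in> {0..1}" using st by auto
  have l1: "a1 \<longlonglongrightarrow> d\<^sub>G x (\<gamma> s)" and l2: "a2 \<longlonglongrightarrow> d\<^sub>G (\<gamma> s) (\<gamma> t)" and l3: "a3 \<longlonglongrightarrow> d\<^sub>G (\<gamma> t) y"
    unfolding a1_def a2_def a3_def
    by (intro dist_sequences_tendsto tendsto_const lim s01 t01 xy in\<Theta> g)+
  have "(\<lambda>n. l * (2 * D * (a1 n + a3 n)) + (a2 n)\<^sup>2) \<longlonglongrightarrow>
      l * (2 * D * (d\<^sub>G x (\<gamma> s) + d\<^sub>G (\<gamma> t) y)) + (d\<^sub>G (\<gamma> s) (\<gamma> t))\<^sup>2"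
    by (intro tendsto_intros l1 l2 l3)
  moreover have "(\<lambda>n. l * (2 - l) * D\<^sup>2 + l * e n) \<longlonglongrightarrow> l * (2 - l) * D\<^sup>2 + l * 0"
    by (intro tendsto_intros e)
  ultimately have le: "l * (2 * D * (d\<^sub>G x (\<gamma> s) + d\<^sub>G (\<gamma> t) y)) + (d\<^sub>G (\<gamma> s) (\<gamma> t))\<^sup>2
      \<le> l * (2 - l) * D\<^sup>2"
    using bound by (simp add: LIMSEQ_le)
  have "D - d\<^sub>G (\<gamma> s) (\<gamma> t) \<le> d\<^sub>G x (\<gamma> s) + d\<^sub>G (\<gamma> t) y"
    using dist_triangle[of x "\<gamma> s" y] dist_triangle[of "\<gamma> s" "\<gamma> t" y] xy g by (simp add: D_def)
  then have "l * (2 * D * (D - d\<^sub>G (\<gamma> s) (\<gamma> t))) \<le> l * (2 * D * (d\<^sub>G x (\<gamma> s) + d\<^sub>G (\<gamma> t) y))"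
    using st dist_nonneg[OF xy] by (intro mult_left_mono) (auto simp: l_def D_def)
  \<comment> \<open>After the triangle inequality has replaced the outer distances, the difference
    of the two sides is this perfect square.\<close>
  with le have "(d\<^sub>G (\<gamma> s) (\<gamma> t) - l * D)\<^sup>2 \<le> 0"
    by (simp add: power2_eq_square algebra_simps)
  then show ?thesis by (simp add: D_def l_def)
qed

text \<open>The bound \<open>D\<^sup>2 + 1\<close> on the energies makes a minimizing sequence
  uniformly Hoelder continuous of exponent 1/2, so Arzela-Ascoli yields a limit curve;
  \<open>limit_constant_speed\<close> identifies its speed.\<close>

lemma geodesic_exists:
  assumes xy: "x \<in> \<Theta>" "y \<in> \<Theta>"
  obtains \<gamma> where "geodesic \<gamma>" "\<gamma> 0 = x" "\<gamma> 1 = y"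
proof -
  obtain c where c: "c > 0" "\<forall>x\<in>\<Theta>. \<forall>v. c * (norm v)\<^sup>2 \<le> v \<bullet> (G x *v v)"
    by (rule coercive)
  define D where "D = d\<^sub>G x y"
  have "\<exists>\<sigma>. \<sigma> \<in> C1_curves \<Theta> x y \<and> energy \<sigma> \<le> D\<^sup>2 + 1 / real (Suc n)" for n
    using near_optimal_curve[OF xy, of "1 / real (Suc n)"] unfolding D_def by (metis less_imp_le of_nat_0_less_iff zero_less_Suc zero_less_divide_1_iff)
  then obtain \<sigma> where \<sigma>: "\<And>n. \<sigma> n \<in> C1_curves \<Theta> x y"
    and energy: "\<And>n. energy (\<sigma> n) \<le> D\<^sup>2 + 1 / real (Suc n)"
    by metis
  have p: "C1_path (\<sigma> n)" "\<sigma> n 0 = x" "\<sigma> n 1 = y" for n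
    using \<sigma>[of n] by (simp_all add: C1_curves_iff)
  obtain M where M: "\<And>z. z \<in> \<Theta> \<Longrightarrow> norm z \<le> M"
    using compact_imp_bounded[OF compact] bounded_iff by blast
  have holder: "c * (norm (\<sigma> n t - \<sigma> n s))\<^sup>2 \<le> (t - s) * (D\<^sup>2 + 1)"
    if "0 \<le> s" "s \<le> t" "t \<le> 1" for n s t
  proof -
    have "integral {s..t} (density (\<sigma> n)) \<le> energy (\<sigma> n)"
      by (rule partial_energy_le[OF p(1) that])
    also have "\<dots> \<le> D\<^sup>2 + 1"
      using energy[of n] by (rule order_trans) simp
    finally have "(t - s) * integral {s..t} (density (\<sigma> n)) \<le> (t - s) * (D\<^sup>2 + 1)"
      using that by (intro mult_left_mono) auto
    with displacement_le_energy[OF c p(1) that] show ?thesis by (rule order_trans)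
  qed
  have holder': "c * (norm (\<sigma> n s - \<sigma> n t))\<^sup>2 \<le> \<bar>s - t\<bar> * (D\<^sup>2 + 1)"
    if "s \<in> {0..1}" "t \<in> {0..1}" for n s t
    using holder[of s t n] holder[of t s n] that by (cases "s \<le> t") (auto simp: norm_minus_commute)
  obtain \<gamma> k where "continuous_on {0..1} \<gamma>" and k: "strict_mono (k :: nat \<Rightarrow> nat)"
    and conv: "\<And>e. 0 < e \<Longrightarrow> \<exists>N. \<forall>n t. n \<ge> N \<and> t \<in> {0..1} \<longrightarrow> norm (\<sigma> (k n) t - \<gamma> t) < e"
  proof (rule Arzela_Ascoli[of "{0..1::real}" \<sigma> M])
    show "norm (\<sigma> n t) \<le> M" if "t \<in> {0..1}" for n t
      using M C1_path_in[OF p(1) that] by blast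
    fix s e :: real assume s: "s \<in> {0..1}" and e: "0 < e"
    define r where "r = c * e\<^sup>2 / (D\<^sup>2 + 1)"
    have D: "D\<^sup>2 + 1 > 0" by (simp add: add_nonneg_pos)
    have "r > 0" using c(1) e D by (simp add: r_def)
    moreover have "norm (\<sigma> n s - \<sigma> n t) < e" if "t \<in> {0..1}" "norm (s - t) < r" for n t
    proof -
      have "c * (norm (\<sigma> n s - \<sigma> n t))\<^sup>2 \<le> \<bar>s - t\<bar> * (D\<^sup>2 + 1)"
        by (rule holder'[OF s that(1)])
      also have "\<dots> < c * e\<^sup>2"
        using that(2) D by (simp add: r_def pos_less_divide_eq)
      finally have "(norm (\<sigma> n s - \<sigma> n t))\<^sup>2 < e\<^sup>2" using c(1) by simp
      then show ?thesis using e by (simp add: power2_less_imp_less)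
    qed
    ultimately show "\<exists>d. 0 < d \<and> (\<forall>n t. t \<in> {0..1} \<and> norm (s - t) < d \<longrightarrow> norm (\<sigma> n s - \<sigma> n t) < e)"
      by blast
  next
    fix g and k :: "nat \<Rightarrow> nat"
    assume g: "continuous_on {0..1} g" and k: "strict_mono k"
      and conv: "\<And>e. 0 < e \<Longrightarrow> \<exists>N. \<forall>n t. N \<le> n \<and> t \<in> {0..1} \<longrightarrow> norm (\<sigma> (k n) t - g t) < e"
    show thesis by (rule that[OF g k conv])
  qed simp
  have lim: "(\<lambda>n. \<sigma> (k n) t) \<longlonglongrightarrow> \<gamma> t" if "t \<in> {0..1}" for t
    using conv that unfolding LIMSEQ_def dist_norm by blast
  have \<gamma>: "\<gamma> t \<in> \<Theta>" if "t \<in> {0..1}" for t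
    using closed_sequentially[OF compact_imp_closed[OF compact] _ lim[OF that]] C1_path_in[OF p(1) that]
    by blast
  have ends: "\<gamma> 0 = x" "\<gamma> 1 = y"
    using LIMSEQ_unique[OF lim[of 0]] LIMSEQ_unique[OF lim[of 1]] p by auto
  have e: "(\<lambda>n. 1 / real (Suc (k n))) \<longlonglongrightarrow> 0"
    using LIMSEQ_subseq_LIMSEQ[OF lim_1_over_n[THEN LIMSEQ_Suc] k] by (simp add: o_def)
  have speed: "d\<^sub>G (\<gamma> s) (\<gamma> t) = (t - s) * D" if "0 \<le> s" "s \<le> t" "t \<le> 1" for s t
    unfolding D_def using energy
    by (intro limit_constant_speed[OF xy _ _ e lim \<gamma> that]) (simp_all add: \<sigma> D_def)
  have "d\<^sub>G (\<gamma> s) (\<gamma> t) = \<bar>s - t\<bar> * d\<^sub>G (\<gamma> 0) (\<gamma> 1)" if "s \<in> {0..1}" "t \<in> {0..1}" for s t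
    using speed[of s t] speed[of t s] dist_sym[OF \<gamma>[OF that(1)] \<gamma>[OF that(2)]] that
    by (cases "s \<le> t") (auto simp: ends D_def)
  then have "geodesic \<gamma>"
    unfolding geodesic_def using \<gamma> by blast
  then show ?thesis using ends by (rule that)
qed

end

section \<open>Gradient flows of geodesically convex functions\<close>

text \<open>\<open>gr\<close> is the Euclidean gradient of \<open>F\<close>, and \<open>W\<close> is
  minus its gradient with respect to \<open>G\<close>. Differentiability in full neighbourhoods also
  covers boundary points of \<open>\<Theta>\<close>.\<close>

locale convex_gradient_flow = riemannian_region \<Theta> G
  for \<Theta> :: "(real ^ 'd) set" and G :: "real ^ 'd \<Rightarrow> real ^ 'd ^ 'd" +
  fixes F :: "real ^ 'd \<Rightarrow> real" and gr W :: "real ^ 'd \<Rightarrow> real ^ 'd" and \<kappa> :: real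
  assumes gradient: "x \<in> \<Theta> \<Longrightarrow> (F has_derivative (\<lambda>v. gr x \<bullet> v)) (at x)"
    and field: "x \<in> \<Theta> \<Longrightarrow> G x *v W x = - gr x"
    and continuous_field: "continuous_on \<Theta> W"
    and kappa_pos: "\<kappa> > 0"
    and convex: "geodesic \<gamma> \<Longrightarrow> t \<in> {0..1} \<Longrightarrow>
      F (\<gamma> t) \<le> (1 - t) * F (\<gamma> 0) + t * F (\<gamma> 1) - \<kappa> / 2 * t * (1 - t) * (d\<^sub>G (\<gamma> 0) (\<gamma> 1))\<^sup>2"
begin

definition slope2 :: "real ^ 'd \<Rightarrow> real" where
  "slope2 x = W x \<bullet> (G x *v W x)"

lemma slope2_eq: "x \<in> \<Theta> \<Longrightarrow> gr x \<bullet> W x = - slope2 x"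
  by (simp add: slope2_def field inner_commute)

lemma continuous_on_slope2: "continuous_on \<Theta> slope2"
  unfolding slope2_def by (intro continuous_on_G_form continuous_field continuous_on_id) auto

text \<open>Young's inequality with time scale \<open>l\<close>, obtained by expanding the
  nonnegative form of \<open>G x\<close> at \<open>l *\<^sub>R W x - v\<close>.\<close>

lemma decrease_rate_le:
  assumes "x \<in> \<Theta>" "l > 0"
  shows "- (gr x \<bullet> v) \<le> l * slope2 x / 2 + v \<bullet> (G x *v v) / (2 * l)"
proof -
  have sym: "W x \<bullet> (G x *v v) = v \<bullet> (G x *v W x)"
    by (rule inner_matrix_symmetric[OF symmetric[OF assms(1)]])
  have "0 \<le> (l *\<^sub>R W x - v) \<bullet> (G x *v (l *\<^sub>R W x - v))"
    by (rule nonneg[OF assms(1)])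
  also have "\<dots> = l\<^sup>2 * slope2 x - 2 * l * (v \<bullet> (G x *v W x)) + v \<bullet> (G x *v v)"
    by (simp add: slope2_def matrix_vector_mult_diff_distrib matrix_vector_mult_scaleR
        inner_diff_left inner_diff_right sym power2_eq_square algebra_simps)
  also have "v \<bullet> (G x *v W x) = - (gr x \<bullet> v)"
    using assms(1) by (simp add: field inner_commute)
  finally show ?thesis
    using assms(2) by (simp add: field_simps power2_eq_square)
qed

lemma decrease_le_energy:
  assumes \<sigma>: "\<sigma> \<in> C1_curves \<Theta> x y" and l: "l > 0"
    and M: "\<And>t. t \<in> {0..1} \<Longrightarrow> slope2 (\<sigma> t) \<le> M"
  shows "F x - F y \<le> l * M / 2 + energy \<sigma> / (2 * l)"
proof -
  have p: "C1_path \<sigma>" "\<sigma> 0 = x" "\<sigma> 1 = y" using \<sigma> by (simp_all add: C1_curves_iff)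
  have int: "density \<sigma> integrable_on {0..1}" by (intro density_integrable p) auto
  let ?g = "\<lambda>t. l * M / 2 + density \<sigma> t / (2 * l)"
  have "- F (\<sigma> 1) - - F (\<sigma> 0) \<le> integral {0..1} ?g"
  proof (rule derivative_le_imp_diff_le_integral)
    fix t :: real assume t: "t \<in> {0..1}"
    then have \<sigma>t: "\<sigma> t \<in> \<Theta>" by (rule C1_path_in[OF p(1)])
    have "(\<sigma> has_derivative (\<lambda>h. h *\<^sub>R vel \<sigma> t)) (at t within {0..1})"
      using vel_works[OF p(1) t] by (simp add: has_vector_derivative_def has_derivative_at_withinI)
    from has_derivative_compose[OF this gradient[OF \<sigma>t]]
    have "((\<lambda>t. - F (\<sigma> t)) has_derivative (\<lambda>h. - (gr (\<sigma> t) \<bullet> (h *\<^sub>R vel \<sigma> t)))) (at t within {0..1})"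
      by (rule has_derivative_minus)
    then show "((\<lambda>t. - F (\<sigma> t)) has_real_derivative - (gr (\<sigma> t) \<bullet> vel \<sigma> t)) (at t within {0..1})"
      unfolding has_field_derivative_def by (rule has_derivative_eq_rhs) (simp add: fun_eq_iff)
    have "- (gr (\<sigma> t) \<bullet> vel \<sigma> t) \<le> l * slope2 (\<sigma> t) / 2 + density \<sigma> t / (2 * l)"
      by (rule decrease_rate_le[OF \<sigma>t l])
    also have "\<dots> \<le> ?g t"
      using M[OF t] l by simp
    finally show "- (gr (\<sigma> t) \<bullet> vel \<sigma> t) \<le> ?g t" .
  next
    show "?g integrable_on {0..1}"
      by (intro integrable_add integrable_on_divide int integrable_const_ivl)
  qed simp
  also have "integral {0..1} ?g = l * M / 2 + energy \<sigma> / (2 * l)"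
    unfolding curve_energy_def
    by (subst Henstock_Kurzweil_Integration.integral_add) (auto intro: integrable_on_divide int)
  finally show ?thesis by (simp add: p)
qed

text \<open>A near-optimal curve to a nearby point stays close to \<open>x\<close> in the Euclidean
  norm by coercivity, so \<open>slope2\<close> along it exceeds its value at \<open>x\<close> by at
  most \<open>e\<close>.\<close>

lemma local_decrease:
  assumes x: "x \<in> \<Theta>" and e: "e > 0"
  obtains r where "r > 0"
    and "\<And>y l. y \<in> \<Theta> \<Longrightarrow> (d\<^sub>G x y)\<^sup>2 < r \<Longrightarrow> l > 0 \<Longrightarrow>
      F x - F y \<le> l * (slope2 x + e) / 2 + (d\<^sub>G x y)\<^sup>2 / (2 * l)"
proof -
  obtain c where c: "c > 0" "\<forall>x\<in>\<Theta>. \<forall>v. c * (norm v)\<^sup>2 \<le> v \<bullet> (G x *v v)"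
    by (rule coercive)
  obtain \<rho> where \<rho>: "\<rho> > 0" "\<And>z. z \<in> \<Theta> \<Longrightarrow> dist z x < \<rho> \<Longrightarrow> dist (slope2 z) (slope2 x) < e"
    using continuous_on_slope2 x e unfolding continuous_on_iff by blast
  show ?thesis
  proof (rule that)
    show "c * \<rho>\<^sup>2 > 0" using c \<rho> by simp
    fix y and l :: real
    assume y: "y \<in> \<Theta>" and near: "(d\<^sub>G x y)\<^sup>2 < c * \<rho>\<^sup>2" and l: "l > 0"
    show "F x - F y \<le> l * (slope2 x + e) / 2 + (d\<^sub>G x y)\<^sup>2 / (2 * l)"
    proof (rule field_le_epsilon)
      fix \<eta> :: real assume \<eta>: "\<eta> > 0"
      \<comment> \<open>The first bound makes the excess energy cost at most \<eta> after division
        by \<open>2 * l\<close>; the second confines the curve to the ball of radius \<rho>.\<close>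
      define \<epsilon> where "\<epsilon> = min (2 * l * \<eta>) (c * \<rho>\<^sup>2 - (d\<^sub>G x y)\<^sup>2)"
      have "\<epsilon> > 0" using \<eta> l near by (simp add: \<epsilon>_def)
      then obtain \<sigma> where \<sigma>: "\<sigma> \<in> C1_curves \<Theta> x y" "energy \<sigma> < (d\<^sub>G x y)\<^sup>2 + \<epsilon>"
        using near_optimal_curve[OF x y] by blast
      then have p: "C1_path \<sigma>" "\<sigma> 0 = x" by (simp_all add: C1_curves_iff)
      have "slope2 (\<sigma> t) \<le> slope2 x + e" if t: "t \<in> {0..1}" for t
      proof -
        have t': "0 \<le> t" "t \<le> 1" using t by auto
        have "c * (norm (\<sigma> t - \<sigma> 0))\<^sup>2 \<le> (t - 0) * integral {0..t} (density \<sigma>)"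
          using t' by (intro displacement_le_energy[OF c p(1)]) auto
        also have "\<dots> \<le> 1 * integral {0..t} (density \<sigma>)"
          using t' density_nonneg[OF p(1)]
          by (intro mult_right_mono integral_nonneg density_integrable p) auto
        also have "\<dots> \<le> energy \<sigma>"
          using partial_energy_le[OF p(1), of 0 t] t' by simp
        also have "\<dots> < c * \<rho>\<^sup>2"
          using \<sigma>(2) by (simp add: \<epsilon>_def)
        finally have "(norm (\<sigma> t - x))\<^sup>2 < \<rho>\<^sup>2" using c(1) p by simp
        then have "dist (\<sigma> t) x < \<rho>"
          using \<rho>(1) by (simp add: dist_norm power2_less_imp_less)
        from \<rho>(2)[OF C1_path_in[OF p(1) t] this] show ?thesis
          by (simp add: dist_real_def)
      qed
      then have "F x - F y \<le> l * (slope2 x + e) / 2 + energy \<sigma> / (2 * l)"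
        by (rule decrease_le_energy[OF \<sigma>(1) l])
      also have "energy \<sigma> / (2 * l) \<le> ((d\<^sub>G x y)\<^sup>2 + 2 * l * \<eta>) / (2 * l)"
        using \<sigma>(2) l by (intro divide_right_mono) (auto simp: \<epsilon>_def)
      also have "\<dots> = (d\<^sub>G x y)\<^sup>2 / (2 * l) + \<eta>"
        using l by (simp add: field_simps)
      finally show "F x - F y \<le> l * (slope2 x + e) / 2 + (d\<^sub>G x y)\<^sup>2 / (2 * l) + \<eta>"
        by simp
    qed
  qed
qed

text \<open>Compare the decrease of \<open>F\<close> along a geodesic from \<open>x\<close> to \<open>y\<close>, bounded below by convexity,
  with the bound of \<open>local_decrease\<close> at \<open>l = t / \<kappa>\<close>, and let \<open>t\<close> tend to zero.\<close>

lemma polyak_lojasiewicz: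
  assumes x: "x \<in> \<Theta>" and y: "y \<in> \<Theta>"
  shows "2 * \<kappa> * (F x - F y) \<le> slope2 x"
proof (rule field_le_epsilon)
  fix e :: real assume e: "e > 0"
  obtain \<gamma> where \<gamma>: "geodesic \<gamma>" "\<gamma> 0 = x" "\<gamma> 1 = y"
    using geodesic_exists[OF x y] .
  define D where "D = d\<^sub>G x y"
  obtain r where r: "r > 0" and dec: "\<And>y l. y \<in> \<Theta> \<Longrightarrow> (d\<^sub>G x y)\<^sup>2 < r \<Longrightarrow> l > 0 \<Longrightarrow>
      F x - F y \<le> l * (slope2 x + e) / 2 + (d\<^sub>G x y)\<^sup>2 / (2 * l)"
    using local_decrease[OF x e] by metis
  have "((\<lambda>t. (t * D)\<^sup>2) \<longlongrightarrow> (0 * D)\<^sup>2) (at_right 0)"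
    by (intro tendsto_intros)
  then have "\<forall>\<^sub>F t in at_right 0. (t * D)\<^sup>2 < r"
    using r by (intro order_tendstoD(2)) auto
  moreover have "\<forall>\<^sub>F t in at_right 0. t < (1::real)"
    by (rule order_tendstoD(2)[OF tendsto_ident_at]) simp
  ultimately have "\<forall>\<^sub>F t in at_right 0. 2 * \<kappa> * (F x - F y) \<le> slope2 x + e + \<kappa>\<^sup>2 * D\<^sup>2 * t"
    using eventually_at_right_less[of 0]
  proof eventually_elim
    case (elim t)
    then have t: "t \<in> {0..1}" by auto
    have dt: "d\<^sub>G x (\<gamma> t) = t * D"
      using geodesic_speed[OF \<gamma>(1), of 0 t] t by (simp add: \<gamma>(2,3) D_def)
    have "\<gamma> t \<in> \<Theta>" using \<gamma> t by (auto simp: geodesic_def)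
    \<comment> \<open>For this \<open>l\<close> the last term becomes
      \<open>\<kappa> / 2 * t * D\<^sup>2\<close> and cancels the convexity gain up to order
      \<open>t\<^sup>2\<close>, so \<open>D\<close> disappears in the limit.\<close>
    then have "F x - F (\<gamma> t) \<le> t / \<kappa> * (slope2 x + e) / 2 + (t * D)\<^sup>2 / (2 * (t / \<kappa>))"
      using dec[of "\<gamma> t" "t / \<kappa>"] elim kappa_pos by (simp add: dt)
    also have "(t * D)\<^sup>2 / (2 * (t / \<kappa>)) = \<kappa> / 2 * t * D\<^sup>2"
      using elim kappa_pos by (simp add: field_simps power2_eq_square)
    finally have "t * (F x - F y) + \<kappa> / 2 * t * (1 - t) * D\<^sup>2 \<le> t / \<kappa> * (slope2 x + e) / 2 + \<kappa> / 2 * t * D\<^sup>2"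
      using convex[OF \<gamma>(1) t] by (simp add: \<gamma> D_def algebra_simps)
    then have "t * (2 * \<kappa> * (F x - F y)) \<le> t * (slope2 x + e + \<kappa>\<^sup>2 * D\<^sup>2 * t)"
      using kappa_pos by (simp add: field_simps power2_eq_square)
    then show ?case using elim by simp
  qed
  moreover have "((\<lambda>t. slope2 x + e + \<kappa>\<^sup>2 * D\<^sup>2 * t) \<longlongrightarrow> slope2 x + e + \<kappa>\<^sup>2 * D\<^sup>2 * 0) (at_right 0)"
    by (intro tendsto_intros)
  ultimately show "2 * \<kappa> * (F x - F y) \<le> slope2 x + e"
    using tendsto_lowerbound[where F = "at_right 0"] by force
qed

text \<open>Minimality gives \<open>F m \<le> F (\<gamma> t)\<close>. Dividing the convexity
  inequality by \<open>t\<close> and letting \<open>t\<close> tend to zero removes the factor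
  \<open>1 - t\<close>.\<close>

lemma quadratic_growth:
  assumes m: "m \<in> \<Theta>" "\<And>z. z \<in> \<Theta> \<Longrightarrow> F m \<le> F z" and x: "x \<in> \<Theta>"
  shows "\<kappa> / 2 * (d\<^sub>G m x)\<^sup>2 \<le> F x - F m"
proof -
  obtain \<gamma> where \<gamma>: "geodesic \<gamma>" "\<gamma> 0 = m" "\<gamma> 1 = x"
    using geodesic_exists[OF m(1) x] .
  have "\<forall>\<^sub>F t in at_right 0. t < (1::real)"
    by (rule order_tendstoD(2)[OF tendsto_ident_at]) simp
  then have "\<forall>\<^sub>F t in at_right 0. \<kappa> / 2 * (1 - t) * (d\<^sub>G m x)\<^sup>2 \<le> F x - F m"
    using eventually_at_right_less[of 0]
  proof eventually_elim
    case (elim t)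
    then have t: "t \<in> {0..1}" by auto
    then have "F m \<le> F (\<gamma> t)" using \<gamma> by (intro m) (auto simp: geodesic_def)
    also have "\<dots> \<le> (1 - t) * F m + t * F x - \<kappa> / 2 * t * (1 - t) * (d\<^sub>G m x)\<^sup>2"
      using convex[OF \<gamma>(1) t] by (simp add: \<gamma>)
    finally have "t * (\<kappa> / 2 * (1 - t) * (d\<^sub>G m x)\<^sup>2) \<le> t * (F x - F m)"
      by (simp add: algebra_simps)
    then show ?case using elim by simp
  qed
  moreover have "((\<lambda>t. \<kappa> / 2 * (1 - t) * (d\<^sub>G m x)\<^sup>2) \<longlongrightarrow> \<kappa> / 2 * (1 - 0) * (d\<^sub>G m x)\<^sup>2) (at_right 0)"
    by (intro tendsto_intros)
  ultimately have "\<kappa> / 2 * (1 - 0) * (d\<^sub>G m x)\<^sup>2 \<le> F x - F m"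
    by (intro tendsto_upperbound[where F = "at_right (0::real)"]) (assumption | simp)+
  then show ?thesis by simp
qed

section \<open>Existence and uniqueness of minimizers\<close>

lemma minimizer_exists:
  assumes "\<Theta> \<noteq> {}"
  obtains m where "m \<in> \<Theta>" "\<And>z. z \<in> \<Theta> \<Longrightarrow> F m \<le> F z"
proof -
  have "continuous_on \<Theta> F"
    using gradient has_derivative_continuous by (intro continuous_at_imp_continuous_on) blast
  then show ?thesis
    using continuous_attains_inf[OF compact assms] that by blast
qed

lemma minimizer_unique:
  assumes m: "m \<in> \<Theta>" "\<And>z. z \<in> \<Theta> \<Longrightarrow> F m \<le> F z" and x: "x \<in> \<Theta>" "F x \<le> F m"
  shows "x = m"
proof -
  have "\<kappa> / 2 * (d\<^sub>G m x)\<^sup>2 \<le> 0"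
    using quadratic_growth[OF m x(1)] x(2) by simp
  then have "d\<^sub>G m x = 0"
    using kappa_pos by (simp add: mult_le_0_iff)
  then show ?thesis using dist_eq_0_iff m x by auto
qed

section \<open>Behaviour along flow lines\<close>

definition flow_line :: "(real \<Rightarrow> real ^ 'd) \<Rightarrow> bool" where
  "flow_line u \<longleftrightarrow>
     (\<forall>t\<ge>0. u t \<in> \<Theta> \<and> (u has_vector_derivative W (u t)) (at t within {0..}))"

lemma exponential_decay:
  assumes u: "flow_line u" and m: "m \<in> \<Theta>" and t: "t \<ge> 0"
  shows "F (u t) - F m \<le> exp (- 2 * \<kappa> * t) * (F (u 0) - F m)"
proof -
  define h where "h = (\<lambda>t. exp (2 * \<kappa> * t) * (F (u t) - F m))"
  define h' where "h' = (\<lambda>t. exp (2 * \<kappa> * t) * (2 * \<kappa> * (F (u t) - F m) - slope2 (u t)))"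
  have d: "(h has_real_derivative h' s) (at s within {0..})" if s: "s \<ge> 0" for s
  proof -
    have us: "u s \<in> \<Theta>" and "(u has_derivative (\<lambda>h. h *\<^sub>R W (u s))) (at s within {0..})"
      using u s by (auto simp: flow_line_def has_vector_derivative_def)
    from has_derivative_compose[OF this(2) gradient[OF us]]
    have "((\<lambda>s. F (u s)) has_real_derivative - slope2 (u s)) (at s within {0..})"
      unfolding has_field_derivative_def
      by (rule has_derivative_eq_rhs) (simp add: fun_eq_iff slope2_eq[OF us])
    then show ?thesis
      unfolding h_def h'_def by (auto intro!: derivative_eq_intros simp: algebra_simps)
  qed
  have "h t \<le> h 0"
  \<comment> \<open>At time 0 the flow has only a one-sided derivative, so signs are checked on the
    open interval and continuity handles the ends. There \<open>h' s \<le> 0\<close> is the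
    Polyak-Lojasiewicz inequality.\<close>
  proof (rule DERIV_nonpos_imp_decreasing_open[OF t])
    fix s assume s: "0 < s" "s < t"
    then have "at s within {0..} = at s"
      by (intro at_within_interior) (auto simp: interior_real_atLeast)
    moreover have "h' s \<le> 0"
      using polyak_lojasiewicz[OF _ m, of "u s"] u s
      by (auto simp: h'_def flow_line_def intro!: mult_nonneg_nonpos)
    ultimately show "\<exists>y. (h has_real_derivative y) (at s) \<and> y \<le> 0"
      using d[of s] s by auto
  next
    show "continuous_on {0..t} h"
      using d by (intro DERIV_continuous_on[of _ _ h'] DERIV_subset[OF d]) auto
  qed
  then have "exp (2 * \<kappa> * t) * (F (u t) - F m) \<le> F (u 0) - F m"
    by (simp add: h_def)
  then have "exp (- 2 * \<kappa> * t) * (exp (2 * \<kappa> * t) * (F (u t) - F m))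
      \<le> exp (- 2 * \<kappa> * t) * (F (u 0) - F m)"
    by (rule mult_left_mono) simp
  then show ?thesis
    by (simp add: mult.assoc[symmetric] exp_add[symmetric])
qed

text \<open>Quadratic growth and coercivity bound the squared Euclidean distance by a multiple of
  \<open>F (u t) - F m\<close>; taking the root halves the rate to \<kappa>.\<close>

lemma exponential_convergence:
  assumes u: "flow_line u" and m: "m \<in> \<Theta>" "\<And>z. z \<in> \<Theta> \<Longrightarrow> F m \<le> F z"
  obtains C where "\<And>t. t \<ge> 0 \<Longrightarrow> dist (u t) m \<le> C * exp (- \<kappa> * t)"
proof -
  obtain c where c: "c > 0" "\<forall>x\<in>\<Theta>. \<forall>v. c * (norm v)\<^sup>2 \<le> v \<bullet> (G x *v v)"
    by (rule coercive)
  define A where "A = 2 / (\<kappa> * c) * (F (u 0) - F m)"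
  have "u 0 \<in> \<Theta>" using u by (simp add: flow_line_def)
  then have A: "A \<ge> 0" using m kappa_pos c by (simp add: A_def)
  have "dist (u t) m \<le> sqrt A * exp (- \<kappa> * t)" if t: "t \<ge> 0" for t
  proof (rule power2_le_imp_le)
    have ut: "u t \<in> \<Theta>" using u t by (simp add: flow_line_def)
    have "\<kappa> / 2 * (c * (norm (m - u t))\<^sup>2) \<le> \<kappa> / 2 * (d\<^sub>G m (u t))\<^sup>2"
      using norm_le_dist[OF c m(1) ut] kappa_pos by (intro mult_left_mono) auto
    also have "\<dots> \<le> F (u t) - F m"
      by (rule quadratic_growth[OF m ut])
    also have "\<dots> \<le> exp (- 2 * \<kappa> * t) * (F (u 0) - F m)"
      by (rule exponential_decay[OF u m(1) t])
    finally have "(norm (m - u t))\<^sup>2 \<le> A * exp (- 2 * \<kappa> * t)"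
      using kappa_pos c(1) by (simp add: A_def field_simps)
    also have "\<dots> = (sqrt A * exp (- \<kappa> * t))\<^sup>2"
      using A by (simp add: power_mult_distrib flip: exp_double)
    finally show "(dist (u t) m)\<^sup>2 \<le> (sqrt A * exp (- \<kappa> * t))\<^sup>2"
      by (simp add: dist_norm norm_minus_commute)
  qed (use A in simp)
  then show ?thesis by (rule that)
qed

text \<open>The minimizer may lie on the boundary of \<open>\<Theta>\<close>, where the gradient need not vanish; that it
  does follows from the flow line issuing from it, which must be constant.\<close>

lemma minimizer_stationary:
  assumes m: "m \<in> \<Theta>" "\<And>z. z \<in> \<Theta> \<Longrightarrow> F m \<le> F z" and u: "flow_line u" "u 0 = m"
  shows "W m = 0"
proof -
  \<comment> \<open>Decay from \<open>u 0 = m\<close> bounds \<open>F (u t)\<close> by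
    \<open>F m\<close>, so \<open>u t\<close> is again a minimizer.\<close>
  have const: "u t = m" if "t \<ge> 0" for t
    using exponential_decay[OF u(1) m(1) that] u that
    by (intro minimizer_unique[OF m]) (auto simp: flow_line_def)
  have "(u has_vector_derivative W m) (at 0 within {0..})"
    using u by (auto simp: flow_line_def)
  moreover have "((\<lambda>_. m) has_vector_derivative 0) (at 0 within {0..})"
    by (rule has_vector_derivative_const)
  then have "(u has_vector_derivative 0) (at 0 within {0..})"
    by (rule has_vector_derivative_transform[rotated 2]) (auto simp: const)
  moreover have "at (0::real) within {0..} \<noteq> bot"
    by (simp add: at_within_Ici_at_right)
  ultimately show ?thesis
    by (rule vector_derivative_unique_within[rotated])
qed

lemma stationary_iff_minimizer:
  assumes m: "m \<in> \<Theta>" "\<And>z. z \<in> \<Theta> \<Longrightarrow> F m \<le> F z" and u: "flow_line u" "u 0 = m"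
  shows "x \<in> \<Theta> \<and> W x = 0 \<longleftrightarrow> x = m"
proof
  assume x: "x \<in> \<Theta> \<and> W x = 0"
  then have "2 * \<kappa> * (F x - F m) \<le> 0"
    using polyak_lojasiewicz[of x m] m by (simp add: slope2_def)
  then have "F x \<le> F m"
    using kappa_pos by (simp add: mult_le_0_iff)
  with x show "x = m" by (intro minimizer_unique[OF m]) auto
qed (use m minimizer_stationary[OF m u] in simp)

end

section \<open>The Fokker-Planck equation on parameter space\<close>

text \<open>The coordinates of \<open>p\<close> sum to 1 on the open set \<open>U\<close>, so the
  columns of the Jacobi matrix are tangent to the simplex.\<close>

lemma sum_jacobian_eq_0:
  fixes p :: "real ^ 'd \<Rightarrow> real ^ 'n"
  assumes U: "open U" "p ` U \<subseteq> pos_prob" and x: "x \<in> U" and d: "p differentiable (at x)"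
  shows "(\<Sum>i\<in>UNIV. (jacobian p (at x) *v h) $ i) = 0"
proof -
  have "(p has_derivative (\<lambda>h. jacobian p (at x) *v h)) (at x)"
    using d by (simp add: jacobian_works)
  then have "((\<lambda>y. \<Sum>i\<in>UNIV. p y $ i) has_derivative
      (\<lambda>h. \<Sum>i\<in>UNIV. (jacobian p (at x) *v h) $ i)) (at x)"
    by (intro has_derivative_sum bounded_linear.has_derivative[OF bounded_linear_vec_nth])
  moreover have "((\<lambda>y. \<Sum>i\<in>UNIV. p y $ i) has_derivative (\<lambda>h. 0)) (at x)"
    by (rule has_derivative_transform_within_open[OF has_derivative_const[of 1] U(1) x])
      (use U in \<open>auto simp: pos_prob_def\<close>)
  ultimately show ?thesis
    using has_derivative_unique by metis
qed

definition log_ratio :: "real ^ 'n \<Rightarrow> real ^ 'n \<Rightarrow> real ^ 'n" where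
  "log_ratio p q = (\<chi> i. ln (p $ i / q $ i))"

text \<open>Differentiating \<open>y * ln (y / q)\<close> leaves an extra summand 1, whose
  contribution vanishes because the columns of the Jacobi matrix sum to zero.\<close>

lemma has_derivative_KL:
  fixes p :: "real ^ 'd \<Rightarrow> real ^ 'n"
  assumes U: "open U" "p ` U \<subseteq> pos_prob" and x: "x \<in> U" and d: "p differentiable (at x)"
    and q: "q \<in> pos_prob"
  shows "((\<lambda>x. KL (p x) q) has_derivative
    (\<lambda>h. (transpose (jacobian p (at x)) *v log_ratio (p x) q) \<bullet> h)) (at x)"
proof -
  let ?J = "jacobian p (at x)"
  have pos: "p x $ i > 0" "q $ i > 0" for i
    using U(2) x q by (auto simp: pos_prob_def)
  have "(p has_derivative (\<lambda>h. ?J *v h)) (at x)"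
    using d by (simp add: jacobian_works)
  then have pi: "((\<lambda>x. p x $ i) has_derivative (\<lambda>h. (?J *v h) $ i)) (at x)" for i
    by (rule bounded_linear.has_derivative[OF bounded_linear_vec_nth])
  have summand: "((\<lambda>x. p x $ i * ln (p x $ i / q $ i)) has_derivative
      (\<lambda>h. (?J *v h) $ i * ln (p x $ i / q $ i) + (?J *v h) $ i)) (at x)" for i
  proof -
    have "((\<lambda>y. y * ln (y / q $ i)) has_real_derivative ln (p x $ i / q $ i) + 1) (at (p x $ i))"
      using pos[of i] by (auto intro!: derivative_eq_intros simp: field_simps)
    from has_derivative_compose[OF pi this[unfolded has_field_derivative_def]]
    show ?thesis by (rule has_derivative_eq_rhs) (simp add: fun_eq_iff algebra_simps)
  qed
  have "((\<lambda>x. KL (p x) q) has_derivative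
      (\<lambda>h. \<Sum>i\<in>UNIV. (?J *v h) $ i * ln (p x $ i / q $ i) + (?J *v h) $ i)) (at x)"
    unfolding KL_def by (intro has_derivative_sum summand)
  then show ?thesis
  proof (rule has_derivative_eq_rhs, intro ext)
    fix h
    have "(\<Sum>i\<in>UNIV. (?J *v h) $ i * ln (p x $ i / q $ i) + (?J *v h) $ i)
        = log_ratio (p x) q \<bullet> (?J *v h)"
      using sum_jacobian_eq_0[OF U x d]
      by (simp add: sum.distrib inner_vec_def log_ratio_def mult.commute)
    also have "\<dots> = (transpose ?J *v log_ratio (p x) q) \<bullet> h"
      by (simp add: dot_lmul_matrix)
    finally show "(\<Sum>i\<in>UNIV. (?J *v h) $ i * ln (p x $ i / q $ i) + (?J *v h) $ i)
        = (transpose ?J *v log_ratio (p x) q) \<bullet> h" .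
  qed
qed

lemma wasserstein_dist_eq_curve_dist:
  "wasserstein_dist E \<omega> \<Theta> p = curve_dist \<Theta> (wasserstein_metric E \<omega> p)"
  by (intro ext) (simp add: wasserstein_dist_def curve_dist_def wasserstein_energy_def curve_energy_def)

section \<open>The pulled-back Wasserstein metric and the Fokker-Planck field\<close>

locale parametrized_model =
  fixes E :: "('n::finite \<times> 'n) set" and \<omega> :: "'n \<Rightarrow> 'n \<Rightarrow> real"
    and \<Theta> U :: "(real ^ 'd) set" and p :: "real ^ 'd \<Rightarrow> real ^ 'n"
  assumes graph: "weighted_graph E \<omega>" and two: "CARD('n) \<ge> 2"
    and U: "open U" "\<Theta> \<subseteq> U" "p ` U \<subseteq> pos_prob"
    and diff: "\<And>x. x \<in> U \<Longrightarrow> p differentiable (at x)"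
    and cont: "continuous_on U (\<lambda>x. jacobian p (at x))"
    and rank: "\<And>x. x \<in> \<Theta> \<Longrightarrow> rank (jacobian p (at x)) = CARD('d)"
begin

lemma prob: "x \<in> \<Theta> \<Longrightarrow> p x \<in> pos_prob"
  using U by auto

lemma continuous_on_p: "continuous_on \<Theta> p"
  using diff U differentiable_imp_continuous_within
  by (intro continuous_at_imp_continuous_on) blast

lemma continuous_on_jacobian: "continuous_on \<Theta> (\<lambda>x. jacobian p (at x))"
  using cont U(2) by (rule continuous_on_subset)

lemma transpose_wasserstein_metric:
  "x \<in> \<Theta> \<Longrightarrow> transpose (wasserstein_metric E \<omega> p x) = wasserstein_metric E \<omega> p x"
  by (simp add: wasserstein_metric_def matrix_transpose_mul matrix_mul_assoc
      pinv_laplacian(3)[OF graph two prob])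

text \<open>Full rank makes the Jacobi matrix injective, and its image lies in the vectors of sum
  zero, where the pseudo-inverse of the Laplacian is positive definite.\<close>

lemma wasserstein_metric_pos:
  assumes x: "x \<in> \<Theta>" and v: "v \<noteq> 0"
  shows "0 < v \<bullet> (wasserstein_metric E \<omega> p x *v v)"
proof -
  let ?J = "jacobian p (at x)"
  have "?J *v v \<noteq> 0"
    using rank[OF x] v by (metis full_rank_injective injD matrix_vector_mult_0_right)
  moreover have "(\<Sum>i\<in>UNIV. (?J *v v) $ i) = 0"
    using x U by (intro sum_jacobian_eq_0[OF U(1,3)] diff) auto
  ultimately have "0 < (?J *v v) \<bullet> (pinv (laplacian E \<omega> (p x)) *v (?J *v v))"
    by (intro pinv_laplacian(4)[OF graph two prob[OF x]])
  also have "\<dots> = v \<bullet> (transpose ?J *v (pinv (laplacian E \<omega> (p x)) *v (?J *v v)))"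
    by (metis dot_lmul_matrix inner_commute transpose_matrix_vector)
  also have "\<dots> = v \<bullet> (wasserstein_metric E \<omega> p x *v v)"
    by (simp only: wasserstein_metric_def matrix_vector_mul_assoc matrix_mul_assoc)
  finally show ?thesis .
qed

lemma continuous_on_wasserstein_metric: "continuous_on \<Theta> (wasserstein_metric E \<omega> p)"
  unfolding wasserstein_metric_def
  by (intro continuous_on_matrix_mult continuous_on_transpose continuous_on_jacobian
      continuous_on_pinv_laplacian[OF graph two prob] continuous_on_p)

lemma invertible_wasserstein_metric: "x \<in> \<Theta> \<Longrightarrow> invertible (wasserstein_metric E \<omega> p x)"
  by (intro positive_definite_invertible wasserstein_metric_pos)

lemma fp_field_eq:
  "x \<in> \<Theta> \<Longrightarrow> fp_field E \<omega> p q x = - (matrix_inv (wasserstein_metric E \<omega> p x) *v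
    (transpose (jacobian p (at x)) *v log_ratio (p x) q))"
  by (simp only: fp_field_def log_ratio_def pinv_invertible[OF invertible_wasserstein_metric])

text \<open>The metric is invertible, so its pseudo-inverse is the inverse and the Fokker-Planck
  field is minus the Riemannian gradient of the divergence.\<close>

lemma wasserstein_metric_fp_field:
  assumes x: "x \<in> \<Theta>"
  shows "wasserstein_metric E \<omega> p x *v fp_field E \<omega> p q x
    = - (transpose (jacobian p (at x)) *v log_ratio (p x) q)"
proof -
  let ?g = "transpose (jacobian p (at x)) *v log_ratio (p x) q"
  let ?G = "wasserstein_metric E \<omega> p x"
  have "?G *v (- (matrix_inv ?G *v ?g)) = - (?G *v (matrix_inv ?G *v ?g))"
    by (simp add: linear_neg)
  also have "?G *v (matrix_inv ?G *v y) = y" for y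
    by (simp only: matrix_vector_mul_assoc matrix_inv_mult[OF invertible_wasserstein_metric[OF x]]
        matrix_vector_mul_lid)
  finally show ?thesis by (simp only: fp_field_eq[OF x])
qed

lemma continuous_on_fp_field:
  assumes q: "q \<in> pos_prob"
  shows "continuous_on \<Theta> (fp_field E \<omega> p q)"
proof -
  have "p x $ i / q $ i \<noteq> 0" "q $ i \<noteq> 0" if "x \<in> \<Theta>" for x i
    using prob[OF that] q by (auto simp: pos_prob_def less_le)
  then have "continuous_on \<Theta> (\<lambda>x. log_ratio (p x) q)"
    unfolding log_ratio_def
    by (intro continuous_on_vec_lambda continuous_on_ln continuous_on_divide continuous_on_component
        continuous_on_p continuous_on_const) auto
  then have "continuous_on \<Theta> (\<lambda>x. - (matrix_inv (wasserstein_metric E \<omega> p x) *v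
      (transpose (jacobian p (at x)) *v log_ratio (p x) q)))"
    by (intro continuous_on_minus continuous_on_matrix_vector_mult continuous_on_matrix_inv
        continuous_on_transpose continuous_on_jacobian continuous_on_wasserstein_metric
        invertible_wasserstein_metric)
  then show ?thesis
    by (rule continuous_on_eq) (simp only: fp_field_eq)
qed

end

theorem proposition9:
  fixes E :: "('n::finite \<times> 'n) set" and \<omega> :: "'n \<Rightarrow> 'n \<Rightarrow> real"
    and \<Theta> :: "(real ^ 'd) set" and p :: "real ^ 'd \<Rightarrow> real ^ 'n"
    and q :: "real ^ 'n" and \<kappa> :: real
  assumes graph: "weighted_graph E \<omega>"
    and dim: "CARD('d) \<le> CARD('n) - 1"
    and model: "statistical_model \<Theta> p"
    and ref: "q \<in> pos_prob"
    and manifold: "riemannian_parameter_space E \<omega> \<Theta> p"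
    and flow: "\<forall>\<theta>0\<in>\<Theta>. \<exists>\<theta>. fp_solution E \<omega> \<Theta> p q \<theta>0 \<theta>"
    and compact: "compact \<Theta>" and nonempty: "\<Theta> \<noteq> {}"
    and ricci: "ricci_ge E \<omega> \<Theta> p q \<kappa>" and pos: "\<kappa> > 0"
  shows "\<exists>\<theta>s. {\<theta>. fp_equilibrium E \<omega> \<Theta> p q \<theta>} = {\<theta>s} \<and>
           {\<theta>. is_arg_min (\<lambda>\<theta>. KL (p \<theta>) q) (\<lambda>\<theta>. \<theta> \<in> \<Theta>) \<theta>} = {\<theta>s} \<and>
           (\<forall>\<theta>0\<in>\<Theta>. \<forall>\<theta>. fp_solution E \<omega> \<Theta> p q \<theta>0 \<theta> \<longrightarrow>
              (\<theta> \<longlongrightarrow> \<theta>s) at_top \<and>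
              (\<exists>C. \<exists>c>0. \<forall>t\<ge>0. dist (\<theta> t) \<theta>s \<le> C * exp (- c * t)) \<and>
              (\<forall>t\<ge>0. KL (p (\<theta> t)) q - KL (p \<theta>s) q
                       \<le> exp (- 2 * \<kappa> * t) * (KL (p \<theta>0) q - KL (p \<theta>s) q)))"
proof -
  obtain U where U: "open U" "\<Theta> \<subseteq> U" "p ` U \<subseteq> pos_prob"
    and diff: "\<forall>x\<in>U. p differentiable (at x)"
    and cont: "continuous_on U (\<lambda>x. jacobian p (at x))"
    and rank: "\<forall>x\<in>\<Theta>. rank (jacobian p (at x)) = CARD('d)"
    using model unfolding statistical_model_def by blast
  \<comment> \<open>Index types are nonempty, so the dimension bound yields the two sample points
    that positive degrees require.\<close>
  have "CARD('d) \<ge> 1" by (simp add: Suc_leI)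
  with dim have two: "CARD('n) \<ge> 2" by linarith
  interpret parametrized_model E \<omega> \<Theta> U p
    using diff rank by unfold_locales (use graph two U cont in auto)
  let ?F = "\<lambda>x. KL (p x) q"
  let ?gr = "\<lambda>x. transpose (jacobian p (at x)) *v log_ratio (p x) q"
  interpret riemannian_region \<Theta> "wasserstein_metric E \<omega> p"
    using manifold unfolding riemannian_parameter_space_def wasserstein_dist_eq_curve_dist
    by unfold_locales
      (simp_all add: compact continuous_on_wasserstein_metric transpose_wasserstein_metric
        wasserstein_metric_pos)
  interpret convex_gradient_flow \<Theta> "wasserstein_metric E \<omega> p" ?F ?gr "fp_field E \<omega> p q" \<kappa>
  proof
    show "(?F has_derivative (\<lambda>v. ?gr x \<bullet> v)) (at x)" if "x \<in> \<Theta>" for x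
      using that U(2) diff by (intro has_derivative_KL[OF U(1,3)] ref) auto
    show "wasserstein_metric E \<omega> p x *v fp_field E \<omega> p q x = - ?gr x" if "x \<in> \<Theta>" for x
      using that by (rule wasserstein_metric_fp_field)
    show "?F (\<gamma> t) \<le> (1 - t) * ?F (\<gamma> 0) + t * ?F (\<gamma> 1) - \<kappa> / 2 * t * (1 - t) * (d\<^sub>G (\<gamma> 0) (\<gamma> 1))\<^sup>2"
      if "geodesic \<gamma>" "t \<in> {0..1}" for \<gamma> t
    proof -
      have "constant_speed_geodesic E \<omega> \<Theta> p \<gamma>"
        using that(1)
        unfolding constant_speed_geodesic_def geodesic_def wasserstein_dist_eq_curve_dist .
      with ricci that(2) show ?thesis
        unfolding ricci_ge_def wasserstein_dist_eq_curve_dist by blast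
    qed
  qed (use pos continuous_on_fp_field[OF ref] in auto)
  have line: "flow_line u \<and> u 0 = \<theta>0" if "fp_solution E \<omega> \<Theta> p q \<theta>0 u" for u \<theta>0
    using that by (simp add: fp_solution_def flow_line_def)
  obtain m where m: "m \<in> \<Theta>" "\<And>z. z \<in> \<Theta> \<Longrightarrow> ?F m \<le> ?F z"
    using minimizer_exists[OF nonempty] by blast
  \<comment> \<open>The solution starting at the minimizer itself; that it stays in
    \<open>\<Theta>\<close> is what forces stationarity at a boundary point.\<close>
  obtain u where u: "flow_line u" "u 0 = m"
    using flow m(1) line by blast
  show ?thesis
  proof (intro exI[of _ m] conjI ballI allI impI)
    show "{\<theta>. fp_equilibrium E \<omega> \<Theta> p q \<theta>} = {m}"
      using stationary_iff_minimizer[OF m u] by (auto simp: fp_equilibrium_def)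
    have "is_arg_min ?F (\<lambda>x. x \<in> \<Theta>) x \<longleftrightarrow> x = m" for x
    proof
      assume "is_arg_min ?F (\<lambda>x. x \<in> \<Theta>) x"
      then show "x = m"
        using m by (intro minimizer_unique[OF m]) (auto simp: is_arg_min_def not_less)
    qed (use m in \<open>auto simp: is_arg_min_def not_less\<close>)
    then show "{\<theta>. is_arg_min ?F (\<lambda>\<theta>. \<theta> \<in> \<Theta>) \<theta>} = {m}" by blast
    fix \<theta>0 \<theta>
    assume "fp_solution E \<omega> \<Theta> p q \<theta>0 \<theta>"
    then have \<theta>: "flow_line \<theta>" "\<theta> 0 = \<theta>0" using line by auto
    obtain C where C: "\<And>t. t \<ge> 0 \<Longrightarrow> dist (\<theta> t) m \<le> C * exp (- \<kappa> * t)"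
      using exponential_convergence[OF \<theta>(1) m] by blast
    then show "\<exists>C. \<exists>c>0. \<forall>t\<ge>0. dist (\<theta> t) m \<le> C * exp (- c * t)"
      using pos by blast
    show "(\<theta> \<longlongrightarrow> m) at_top"
    proof (rule metric_tendsto_imp_tendsto)
      show "((\<lambda>t. C * exp (- \<kappa> * t)) \<longlongrightarrow> 0) at_top"
        using pos by real_asymp
      show "\<forall>\<^sub>F t in at_top. dist (\<theta> t) m \<le> dist (C * exp (- \<kappa> * t)) 0"
        using eventually_ge_at_top[of 0]
        by eventually_elim (use C in \<open>auto simp: dist_real_def intro: order_trans abs_ge_self\<close>)
    qed
    show "KL (p (\<theta> t)) q - KL (p m) q \<le> exp (- 2 * \<kappa> * t) * (KL (p \<theta>0) q - KL (p m) q)"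
      if "0 \<le> t" for t
      using exponential_decay[OF \<theta>(1) m(1) that] by (simp add: \<theta>(2))
  qed
qed

end
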